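(* Let $n,q\ge 1$ and let $f:\mathbb{R}^n\to\mathbb{R}^q$ be a partially defined function with domain $\mathrm{dom}(f)\subseteq\mathbb{R}^n$. Then $f$ is definable in $\mathrm{FO}(\mathbb{R},\mathbb{Z},+,\leq)$ if and only if $f$ is piecewise-simple.
   Context: Functions are partial: $f:X\to Y$ is defined on a set $\mathrm{dom}(f)\subseteq X$, and its graph is $G_f=\{(x,y)\in X\times Y\mid x\in\mathrm{dom}(f),\ y=f(x)\}$. The restriction of $f$ to $D\subseteq\mathrm{dom}(f)$ is denoted $f|_D$. The mixed additive theory $\mathrm{FO}(\mathbb{R},\mathbb{Z},+,\leq)$ is the first-order logic over the real numbers with addition, the order $\leq$, and a unary predicate for membership in $\mathbb{Z}$ (equivalently, with quantification over both reals and integers). A set $S\subseteq\mathbb{R}^m$ is definable in this logic if it is the set of tuples satisfying some formula (without parameters); a partial function $f:\mathbb{R}^n\to\mathbb{R}^q$ is definable in it if its graph $G_f\subseteq\mathbb{R}^{n+q}$ is. A polyhedral convex set of $\mathbb{R}^n$ is a set of the form $C=\{c\in\mathbb{R}^n\mid \forall j\in\{1,\dots,k\}\ \sum_{i=1}^n\alpha_j[i]\,c[i]\ \#_j\ \beta_j\}$ for some finite (possibly empty) sequence of tuples $(\alpha_j,\#_j,\beta_j)\in\mathbb{Q}^n\times\{<,\leq,=,\geq,>\}\times\mathbb{Q}$. A finitely generated monoid is a subset $M\subseteq\mathbb{Z}^n$ of the form $M=P^*=\{0\}\cup\{p_1+\cdots+p_k\mid k\ge 1,\ p_i\in P\}$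 with $P\subseteq\mathbb{Z}^n$ finite. A polinear set is a subset of $\mathbb{R}^n$ of the form $C+b+M=\{c+z\mid c\in C,\ z\in b+M\}$, where $b\in\mathbb{Z}^n$, $M\subseteq\mathbb{Z}^n$ is a finitely generated monoid, and $C\subseteq[0,1)^n$ is a non-empty polyhedral convex set. A semi-polinear set is a finite (possibly empty) union of polinear sets. A scalar partial function $f:\mathbb{R}^n\to\mathbb{R}$ whose domain is a semi-polinear set $D\subseteq\mathbb{R}^n$ is simple if there exist $\alpha\in\mathbb{Q}$ and $a,b\in\mathbb{Q}^n$ such that $f(c+z)=\alpha+\sum_{i=1}^n (a_ic_i+b_iz_i)$ for all $c\in[0,1)^n$ and $z\in\mathbb{Z}^n$ with $c+z\in D$. A partial function $f:\mathbb{R}^n\to\mathbb{R}^q$ with semi-polinear domain is simple if each of its $q$ coordinate functions is simple. A partial function $f:\mathbb{R}^n\to\mathbb{R}^q$ is piecewise-simple if $\mathrm{dom}(f)$ admits a finite partition into semi-polinear sets $D_1,\dots,D_k$ such that $f|_{D_j}$ is simple for each $j$. *)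

theory Defs
  imports "Jordan_Normal_Form.Matrix" "HOL-Library.Disjoint_Sets"
begin

text \<open>
  Tuples in \<open>\<real>\<^sup>n\<close>, \<open>\<int>\<^sup>n\<close> and \<open>\<rat>\<^sup>n\<close> are vectors in \<open>carrier_vec n\<close> over \<open>real\<close>, \<open>int\<close> and
  \<open>rat\<close>, with coordinates indexed from 0. Partial functions are maps, i.e. functions into
  \<open>option\<close>; \<open>dom f\<close>, \<open>Map.graph f\<close> and \<open>f |` D\<close> are their domain, graph and restriction.
\<close>

definition partial_fun :: "nat \<Rightarrow> nat \<Rightarrow> (real vec \<rightharpoonup> real vec) \<Rightarrow> bool" where
  "partial_fun n q f \<longleftrightarrow> dom f \<subseteq> carrier_vec n \<and> ran f \<subseteq> carrier_vec q"


subsection \<open>The mixed additive theory\<close>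

datatype tm = Var nat | Add tm tm

datatype fm =
    Eq tm tm
  | Le tm tm
  | IsInt tm
  | Neg fm
  | Conj fm fm
  | Exists nat fm

fun tm_val :: "(nat \<Rightarrow> real) \<Rightarrow> tm \<Rightarrow> real" where
  "tm_val e (Var i) = e i"
| "tm_val e (Add s t) = tm_val e s + tm_val e t"

fun sat :: "(nat \<Rightarrow> real) \<Rightarrow> fm \<Rightarrow> bool" where
  "sat e (Eq s t) \<longleftrightarrow> tm_val e s = tm_val e t"
| "sat e (Le s t) \<longleftrightarrow> tm_val e s \<le> tm_val e t"
| "sat e (IsInt t) \<longleftrightarrow> tm_val e t \<in> \<int>"
| "sat e (Neg \<phi>) \<longleftrightarrow> \<not> sat e \<phi>"
| "sat e (Conj \<phi> \<psi>) \<longleftrightarrow> sat e \<phi> \<and> sat e \<psi>"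
| "sat e (Exists i \<phi>) \<longleftrightarrow> (\<exists>r. sat (e(i := r)) \<phi>)"

fun tm_vars :: "tm \<Rightarrow> nat set" where
  "tm_vars (Var i) = {i}"
| "tm_vars (Add s t) = tm_vars s \<union> tm_vars t"

fun free_vars :: "fm \<Rightarrow> nat set" where
  "free_vars (Eq s t) = tm_vars s \<union> tm_vars t"
| "free_vars (Le s t) = tm_vars s \<union> tm_vars t"
| "free_vars (IsInt t) = tm_vars t"
| "free_vars (Neg \<phi>) = free_vars \<phi>"
| "free_vars (Conj \<phi> \<psi>) = free_vars \<phi> \<union> free_vars \<psi>"
| "free_vars (Exists i \<phi>) = free_vars \<phi> - {i}"

text \<open>
  The free variables of the defining formula are among the first \<open>m\<close> ones, so the value 0
  given to all other variables is irrelevant and no parameters occur.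
\<close>

definition definable_set :: "nat \<Rightarrow> real vec set \<Rightarrow> bool" where
  "definable_set m S \<longleftrightarrow>
     (\<exists>\<phi>. free_vars \<phi> \<subseteq> {..<m} \<and>
          S = {v \<in> carrier_vec m. sat (\<lambda>i. if i < m then v $ i else 0) \<phi>})"

definition definable_fun :: "nat \<Rightarrow> nat \<Rightarrow> (real vec \<rightharpoonup> real vec) \<Rightarrow> bool" where
  "definable_fun n q f \<longleftrightarrow> definable_set (n + q) {x @\<^sub>v y | x y. (x, y) \<in> Map.graph f}"


subsection \<open>Semi-polinear sets\<close>

definition polyhedral_convex :: "nat \<Rightarrow> real vec set \<Rightarrow> bool" where
  "polyhedral_convex n C \<longleftrightarrow>
     (\<exists>cs :: (rat vec \<times> (real \<Rightarrow> real \<Rightarrow> bool) \<times> rat) list.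
        (\<forall>(\<alpha>, R, \<beta>) \<in> set cs. \<alpha> \<in> carrier_vec n \<and> R \<in> {(<), (\<le>), (=), (\<ge>), (>)}) \<and>
        C = {c \<in> carrier_vec n.
               \<forall>(\<alpha>, R, \<beta>) \<in> set cs. R (\<Sum>i<n. of_rat (\<alpha> $ i) * c $ i) (of_rat \<beta>)})"

text \<open>The empty list contributes the element \<open>0\<close>.\<close>

definition gen_monoid :: "nat \<Rightarrow> int vec set \<Rightarrow> int vec set" where
  "gen_monoid n P = {foldr (+) ps (0\<^sub>v n) | ps. set ps \<subseteq> P}"

definition fg_monoid :: "nat \<Rightarrow> int vec set \<Rightarrow> bool" where
  "fg_monoid n M \<longleftrightarrow> (\<exists>P \<subseteq> carrier_vec n. finite P \<and> M = gen_monoid n P)"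

definition unit_cube :: "nat \<Rightarrow> real vec set" where
  "unit_cube n = {c \<in> carrier_vec n. \<forall>i<n. 0 \<le> c $ i \<and> c $ i < 1}"

definition polinear :: "nat \<Rightarrow> real vec set \<Rightarrow> bool" where
  "polinear n S \<longleftrightarrow>
     (\<exists>C b M. polyhedral_convex n C \<and> C \<noteq> {} \<and> C \<subseteq> unit_cube n \<and>
        b \<in> carrier_vec n \<and> fg_monoid n M \<and>
        S = {c + map_vec real_of_int (b + z) | c z. c \<in> C \<and> z \<in> M})"

definition semi_polinear :: "nat \<Rightarrow> real vec set \<Rightarrow> bool" where
  "semi_polinear n D \<longleftrightarrow> (\<exists>F. finite F \<and> (\<forall>S\<in>F. polinear n S) \<and> D = \<Union>F)"


subsection \<open>Piecewise-simple functions\<close>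

definition simple_scalar :: "nat \<Rightarrow> (real vec \<rightharpoonup> real) \<Rightarrow> bool" where
  "simple_scalar n f \<longleftrightarrow>
     semi_polinear n (dom f) \<and>
     (\<exists>(\<alpha>::rat) (a::rat vec) (b::rat vec). a \<in> carrier_vec n \<and> b \<in> carrier_vec n \<and>
        (\<forall>c \<in> unit_cube n. \<forall>z \<in> carrier_vec n.
           c + map_vec real_of_int z \<in> dom f \<longrightarrow>
           f (c + map_vec real_of_int z) =
             Some (of_rat \<alpha> +
               (\<Sum>i<n. of_rat (a $ i) * c $ i + of_rat (b $ i) * real_of_int (z $ i)))))"

definition simple_fun :: "nat \<Rightarrow> nat \<Rightarrow> (real vec \<rightharpoonup> real vec) \<Rightarrow> bool" where
  "simple_fun n q f \<longleftrightarrow>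
     semi_polinear n (dom f) \<and>
     (\<forall>i<q. simple_scalar n (\<lambda>x. map_option (\<lambda>y. y $ i) (f x)))"

text \<open>
  \<^const>\<open>partition_on\<close> asks for non-empty blocks; the nowhere defined function has the
  partition with no block.
\<close>

definition piecewise_simple :: "nat \<Rightarrow> nat \<Rightarrow> (real vec \<rightharpoonup> real vec) \<Rightarrow> bool" where
  "piecewise_simple n q f \<longleftrightarrow>
     (\<exists>Ds. finite Ds \<and> partition_on (dom f) Ds \<and>
        (\<forall>D\<in>Ds. semi_polinear n D \<and> simple_fun n q (f |` D)))"

end

theory Submission
  imports Defs "HOL-Decision_Procs.MIR"
begin

text \<open>
  Write a real tuple as \<open>c + z\<close> with \<open>c\<close> in the unit cube and \<open>z\<close> integral. Eliminate quantifiers in a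
  formula of the mixed theory; in the result, an integer linear form in \<open>c\<close> is bounded, so its floor takes
  finitely many values, and every atom becomes a Boolean combination of linear constraints on \<open>c\<close> and
  Presburger constraints on \<open>z\<close>. In disjunctive normal form this is a finite union of rectangles
  of a polyhedral set and the solution set of a Presburger system, and the latter is a finite union of
  translated finitely generated monoids. So definable sets are semi-polinear.

  The graph of a definable function is thus a finite union of polinear sets \<open>C + b + M\<close>. As the graph is
  functional, so are \<open>C\<close> and \<open>M\<close>: over the first \<open>n\<close> coordinates, the others are rational affine on \<open>C\<close> and
  rational linear on \<open>M\<close>, which makes the function simple on the projection of the piece. Projections
  and differences of the pieces are definable, hence semi-polinear, which gives a partition. The
  converse direction is definability of floor, fractional part and rational multiples.
\<close>

text \<open>The eliminated formula may contain nested floors, so its atoms need not be linear.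
  Splitting x = c + z removes them: coefficients stay integral, so the part in z can be pulled out
  of a floor, and what remains inside is a form in c alone. Once its floor is fixed, no condition
  links c and z any more, which is exactly the product shape of a polinear set.

  Complements and projections of semi-polinear sets are awkward to construct by hand. They are
  inherited from the logic, so both inclusions between definable and semi-polinear sets serve the
  passage from definable functions to piecewise-simple ones.

  Simplicity demands rational coefficients, although the points are real. The linear algebra
  therefore runs over the rationals: on the rational span of the monoid, and on the rational kernel
  of the constraints that hold with equality on \<open>C\<close>. Since a simple formula restricts
  to subsets, making the projected pieces disjoint does not disturb it.\<close>

hide_const (open) MIR.C MIR.T MIR.F MIR.E MIR.A MIR.\<alpha> MIR.\<beta> MIR.\<sigma>

subsection \<open>Presburger systems\<close>

lemma gen_monoid_zero: "0\<^sub>v n \<in> gen_monoid n P"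
  unfolding gen_monoid_def by (intro CollectI exI[of _ "[]"]) auto

lemma gen_monoid_add: "p \<in> P \<Longrightarrow> z \<in> gen_monoid n P \<Longrightarrow> p + z \<in> gen_monoid n P"
  unfolding gen_monoid_def
proof (elim CollectE exE conjE, intro CollectI)
  fix ps assume "p \<in> P" "z = foldr (+) ps (0\<^sub>v n)" "set ps \<subseteq> P"
  then show "\<exists>ps. p + z = foldr (+) ps (0\<^sub>v n) \<and> set ps \<subseteq> P"
    by (intro exI[of _ "p # ps"]) auto
qed

lemma gen_monoid_induct [consumes 1, case_names zero add]:
  assumes "z \<in> gen_monoid n P"
    and "Q (0\<^sub>v n)"
    and "\<And>p z. p \<in> P \<Longrightarrow> z \<in> gen_monoid n P \<Longrightarrow> Q z \<Longrightarrow> Q (p + z)"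
  shows "Q z"
proof -
  have "set ps \<subseteq> P \<Longrightarrow> foldr (+) ps (0\<^sub>v n) \<in> gen_monoid n P \<and> Q (foldr (+) ps (0\<^sub>v n))" for ps
    by (induction ps) (auto simp: gen_monoid_zero gen_monoid_add assms)
  with assms(1) show ?thesis unfolding gen_monoid_def by auto
qed

lemma gen_monoid_carrier:
  "z \<in> gen_monoid n P \<Longrightarrow> P \<subseteq> carrier_vec n \<Longrightarrow> z \<in> carrier_vec n"
  by (induction rule: gen_monoid_induct) auto

lemma gen_monoid_plus:
  assumes "z \<in> gen_monoid n P" "w \<in> gen_monoid n P" "P \<subseteq> carrier_vec n"
  shows "z + w \<in> gen_monoid n P"
  using assms(1)
proof (induction rule: gen_monoid_induct)
  case zero
  have "w \<in> carrier_vec n" using assms gen_monoid_carrier by blast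
  then show ?case using assms by simp
next
  case (add p z)
  have "p + z + w = p + (z + w)"
    by (rule assoc_add_vec[of _ n]) (use add assms gen_monoid_carrier in blast)+
  then show ?case using add gen_monoid_add by metis
qed

section \<open>Dickson's lemma and integer systems\<close>

text \<open>Dickson's lemma for finitely many functions into the naturals on an arbitrary type, so
  that coordinates, constraint values and residues can be compared at once. If \<open>B\<close>
  works for \<open>G\<close> and \<open>g\<close> is at most \<open>N\<close> on \<open>B\<close>,
  then \<open>B\<close> also dominates every point with \<open>g s > N\<close>; each of the finitely
  many fibres \<open>g s = k\<close> with \<open>k \<le> N\<close> falls to the induction
  hypothesis.\<close>

lemma dickson_finite_dominating:
  fixes G :: "('a \<Rightarrow> nat) set"
  assumes "finite G"
  shows "\<exists>B\<subseteq>S. finite B \<and> (\<forall>s\<in>S. \<exists>b\<in>B. \<forall>g\<in>G. g b \<le> g s)"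
  using assms
proof (induction G arbitrary: S rule: finite_induct)
  case empty
  show ?case
  proof (cases "S = {}")
    case False
    then obtain s where "s \<in> S" by auto
    then show ?thesis by (intro exI[of _ "{s}"]) auto
  qed auto
next
  case (insert g G)
  obtain B where B: "B \<subseteq> S" "finite B" "\<forall>s\<in>S. \<exists>b\<in>B. \<forall>g\<in>G. g b \<le> g s"
    using insert.IH by blast
  \<comment> \<open>The inserted 0 covers an empty \<open>B\<close>.\<close>
  define N where "N = Max (insert 0 (g ` B))"
  have N: "g b \<le> N" if "b \<in> B" for b
    unfolding N_def using B(2) that by (intro Max_ge) auto
  have "\<forall>k. \<exists>B'. B' \<subseteq> {s\<in>S. g s = k} \<and> finite B' \<and>
      (\<forall>s\<in>{s\<in>S. g s = k}. \<exists>b\<in>B'. \<forall>g\<in>G. g b \<le> g s)"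
    by (intro allI insert.IH)
  from choice[OF this] obtain B' where "\<forall>k. B' k \<subseteq> {s\<in>S. g s = k} \<and> finite (B' k) \<and>
      (\<forall>s\<in>{s\<in>S. g s = k}. \<exists>b\<in>B' k. \<forall>g\<in>G. g b \<le> g s)" ..
  then have B': "\<And>k. B' k \<subseteq> {s\<in>S. g s = k}" "\<And>k. finite (B' k)"
    "\<And>k. \<forall>s\<in>{s\<in>S. g s = k}. \<exists>b\<in>B' k. \<forall>g\<in>G. g b \<le> g s"
    by simp_all
  have "\<exists>b\<in>B \<union> (\<Union>k\<le>N. B' k). \<forall>h\<in>insert g G. h b \<le> h s" if s: "s \<in> S" for s
  proof (cases "g s \<le> N")
    case True
    obtain b where b: "b \<in> B' (g s)" "\<forall>h\<in>G. h b \<le> h s" using B'(3)[of "g s"] s by auto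
    moreover have "g b = g s" using B'(1)[of "g s"] b by auto
    ultimately show ?thesis using True by (intro bexI[of _ b]) auto
  next
    case False
    obtain b where "b \<in> B" "\<forall>h\<in>G. h b \<le> h s" using B(3) s by auto
    with N[of b] False show ?thesis by (intro bexI[of _ b]) auto
  qed
  moreover have "B \<union> (\<Union>k\<le>N. B' k) \<subseteq> S" using B(1) B'(1) by blast
  ultimately show ?case using B(2) B'(2)
    by (intro exI[of _ "B \<union> (\<Union>k\<le>N. B' k)"]) auto
qed

definition lin :: "nat \<Rightarrow> (nat \<Rightarrow> int) \<Rightarrow> int vec \<Rightarrow> int" where
  "lin m l z = (\<Sum>i<m. l i * z $ i)"

lemma lin_add: "y \<in> carrier_vec m \<Longrightarrow> z \<in> carrier_vec m \<Longrightarrow> lin m l (y + z) = lin m l y + lin m l z"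
  unfolding lin_def by (auto simp: sum.distrib[symmetric] algebra_simps intro!: sum.cong)

lemma lin_diff: "y \<in> carrier_vec m \<Longrightarrow> z \<in> carrier_vec m \<Longrightarrow> lin m l (y - z) = lin m l y - lin m l z"
  unfolding lin_def by (auto simp: sum_subtractf[symmetric] algebra_simps intro!: sum.cong)

lemma lin_zero: "lin m l (0\<^sub>v m) = 0"
  unfolding lin_def by auto

lemma dvd_lin: "(\<And>i. i < m \<Longrightarrow> d dvd z $ i) \<Longrightarrow> d dvd lin m l z"
  unfolding lin_def by (intro dvd_sum) auto

text \<open>
  On a fixed orthant, order the solutions of a system by comparing all absolute values of
  coordinates and all values of the constraints, within a residue class. A difference of
  comparable solutions solves the homogeneous system, so Dickson's lemma yields both the finitely
  many offsets and the Hilbert basis.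
\<close>

lemma hilbert_basis:
  fixes s :: "nat \<Rightarrow> int" and Ls :: "(nat \<Rightarrow> int) set" and m :: nat and D :: int
  assumes fin: "finite Ls"
  defines "M \<equiv> {y \<in> carrier_vec m. (\<forall>l\<in>Ls. 0 \<le> lin m l y) \<and> (\<forall>i<m. 0 \<le> s i * y $ i \<and> D dvd y $ i)}"
  assumes s: "\<And>i. s i = 1 \<or> s i = - 1"
  obtains P where "finite P" "P \<subseteq> M" "M = gen_monoid m P"
proof -
  define G where "G = (\<lambda>i y. nat (s i * y $ i)) ` {..<m} \<union> (\<lambda>l y. nat (lin m l y)) ` Ls"
  have "finite G" unfolding G_def using fin by auto
  \<comment> \<open>Zero is left out: it lies below every element, and subtracting it would make no
    progress in the descent.\<close>
  then obtain P where P: "P \<subseteq> M - {0\<^sub>v m}" "finite P"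
    "\<And>y. y \<in> M - {0\<^sub>v m} \<Longrightarrow> \<exists>p\<in>P. \<forall>g\<in>G. g p \<le> g y"
    using dickson_finite_dominating[of G "M - {0\<^sub>v m}"] by blast
  have sub: "y \<in> gen_monoid m P" if "y \<in> M" for y
    using that
  \<comment> \<open>The signs \<open>s\<close> turn this sum into the 1-norm of \<open>y\<close>,
    which drops when a nonzero element of \<open>P\<close> below \<open>y\<close> is
    subtracted.\<close>
  proof (induction "\<Sum>i<m. nat (s i * y $ i)" arbitrary: y rule: less_induct)
    case less
    show ?case
    proof (cases "y = 0\<^sub>v m")
      case False
      with less.prems P(3) obtain p where p: "p \<in> P" "\<And>g. g \<in> G \<Longrightarrow> g p \<le> g y" by blast
      have pM: "p \<in> M" "p \<noteq> 0\<^sub>v m" using p(1) P(1) by auto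
      have dims: "p \<in> carrier_vec m" "y \<in> carrier_vec m" using pM less.prems unfolding M_def by auto
      have le: "s i * p $ i \<le> s i * y $ i" if "i < m" for i
      proof -
        have "nat (s i * p $ i) \<le> nat (s i * y $ i)"
          using p(2)[of "\<lambda>y. nat (s i * y $ i)"] that unfolding G_def by auto
        moreover have "0 \<le> s i * p $ i" "0 \<le> s i * y $ i"
          using pM less.prems that unfolding M_def by auto
        ultimately show ?thesis by linarith
      qed
      have lel: "lin m l p \<le> lin m l y" if "l \<in> Ls" for l
      proof -
        have "nat (lin m l p) \<le> nat (lin m l y)"
          using p(2)[of "\<lambda>y. nat (lin m l y)"] that unfolding G_def by auto
        moreover have "0 \<le> lin m l p" "0 \<le> lin m l y"
          using pM less.prems that unfolding M_def by auto
        ultimately show ?thesis by linarith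
      qed
      have diff: "y - p \<in> M"
        using dims le lel pM(1) less.prems unfolding M_def
        by (auto simp: lin_diff right_diff_distrib)
      obtain j where j: "j < m" "p $ j \<noteq> 0"
        using pM(2) dims by (metis carrier_vecD eq_vecI index_zero_vec)
      have pos: "0 \<le> s i * p $ i" if "i < m" for i using pM(1) that unfolding M_def by auto
      have "s j * p $ j > 0" using pos[OF j(1)] j(2) s[of j] by auto
      then have "nat (s j * (y - p) $ j) < nat (s j * y $ j)"
        using le[OF j(1)] dims j(1) by (simp add: right_diff_distrib)
      moreover have "nat (s i * (y - p) $ i) \<le> nat (s i * y $ i)" if "i < m" for i
        using pos[OF that] dims that by (intro nat_mono) (simp add: right_diff_distrib)
      ultimately have "(\<Sum>i<m. nat (s i * (y - p) $ i)) < (\<Sum>i<m. nat (s i * y $ i))"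
        using j(1) by (intro sum_strict_mono_ex1) auto
      then have "y - p \<in> gen_monoid m P" using less.hyps diff by blast
      then have "p + (y - p) \<in> gen_monoid m P" using p(1) gen_monoid_add by blast
      moreover have "p + (y - p) = y" using dims by auto
      ultimately show ?thesis by simp
    qed (simp add: gen_monoid_zero)
  qed
  have "y \<in> M" if "y \<in> gen_monoid m P" for y
    using that
  proof (induction rule: gen_monoid_induct)
    case zero show ?case unfolding M_def by (auto simp: lin_zero)
  next
    case (add p z)
    then have "p \<in> M" using P(1) by auto
    with add show ?case unfolding M_def by (auto simp: lin_add distrib_left)
  qed
  then have "M = gen_monoid m P" using sub by blast
  then show ?thesis using that P by blast
qed

lemma int_system_orthant:
  fixes s :: "nat \<Rightarrow> int" and Ls :: "((nat \<Rightarrow> int) \<times> int) set" and Ds :: "(int \<times> (nat \<Rightarrow> int) \<times> int) set" and m :: nat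
  assumes fin: "finite Ls" "finite Ds" and s: "\<And>i. s i = 1 \<or> s i = - 1"
    and Dpos: "\<And>d l b. (d, l, b) \<in> Ds \<Longrightarrow> d > 0"
  defines "X \<equiv> {z \<in> carrier_vec m. (\<forall>(l, b)\<in>Ls. 0 \<le> lin m l z + b) \<and>
     (\<forall>(d, l, b)\<in>Ds. d dvd lin m l z + b) \<and> (\<forall>i<m. 0 \<le> s i * z $ i)}"
  obtains B P where "finite B" "B \<subseteq> carrier_vec m" "finite P" "P \<subseteq> carrier_vec m"
    "X = (\<Union>b\<in>B. (+) b ` gen_monoid m P)"
proof -
  \<comment> \<open>A common multiple of the moduli: adding a vector divisible by \<open>D\<close>
    preserves every congruence.\<close>
  define D where "D = prod fst Ds"
  have Dd: "d dvd D" if "(d, l, b) \<in> Ds" for d l b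
    unfolding D_def using fin(2) dvd_prodI[of Ds _ fst, OF _ that] by auto
  have D0: "D > 0" unfolding D_def using Dpos by (intro prod_pos) auto
  define M where "M = {y \<in> carrier_vec m. (\<forall>l\<in>fst ` Ls. 0 \<le> lin m l y) \<and>
    (\<forall>i<m. 0 \<le> s i * y $ i \<and> D dvd y $ i)}"
  obtain P where P: "finite P" "P \<subseteq> M" "M = gen_monoid m P"
    by (rule hilbert_basis[of "fst ` Ls" s m D, folded M_def]) (use fin s in auto)
  \<comment> \<open>Comparing each residue together with its complement to \<open>D\<close> forces
    equal residues, so the difference of comparable solutions is divisible by
    \<open>D\<close>.\<close>
  define G where "G = (\<lambda>i y. nat (s i * y $ i)) ` {..<m} \<union> (\<lambda>(l, b) y. nat (lin m l y + b)) ` Ls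
     \<union> (\<lambda>i y. nat (y $ i mod D)) ` {..<m} \<union> (\<lambda>i y. nat (D - y $ i mod D)) ` {..<m}"
  have "finite G" unfolding G_def using fin by auto
  then obtain B where B: "B \<subseteq> X" "finite B"
    "\<And>y. y \<in> X \<Longrightarrow> \<exists>b\<in>B. \<forall>g\<in>G. g b \<le> g y"
    using dickson_finite_dominating[of G X] by blast
  have Xc: "X \<subseteq> carrier_vec m" and Mc: "M \<subseteq> carrier_vec m" unfolding X_def M_def by auto
  have 1: "z \<in> (\<Union>b\<in>B. (+) b ` M)" if z: "z \<in> X" for z
  proof -
    obtain b where b: "b \<in> B" "\<And>g. g \<in> G \<Longrightarrow> g b \<le> g z" using B(3)[OF z] by blast
    have bX: "b \<in> X" using b B by auto
    have dims: "b \<in> carrier_vec m" "z \<in> carrier_vec m" using bX z Xc by auto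
    have "z - b \<in> M" unfolding M_def
    proof (intro CollectI conjI ballI allI impI)
      show "z - b \<in> carrier_vec m" using dims by simp
    next
      fix l assume "l \<in> fst ` Ls"
      then obtain c where c: "(l, c) \<in> Ls" by auto
      have "nat (lin m l b + c) \<le> nat (lin m l z + c)"
        by (rule b(2)[of "\<lambda>y. nat (lin m l y + c)"]) (use c in \<open>force simp: G_def\<close>)
      moreover have "0 \<le> lin m l b + c" "0 \<le> lin m l z + c" using bX z c unfolding X_def by auto
      ultimately show "0 \<le> lin m l (z - b)" using dims by (simp add: lin_diff)
    next
      fix i assume i: "i < m"
      have "nat (s i * b $ i) \<le> nat (s i * z $ i)"
        by (rule b(2)[of "\<lambda>y. nat (s i * y $ i)"]) (use i in \<open>auto simp: G_def\<close>)
      moreover have "0 \<le> s i * b $ i" "0 \<le> s i * z $ i" using bX z i unfolding X_def by auto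
      ultimately show "0 \<le> s i * (z - b) $ i" using dims i by (simp add: right_diff_distrib)
      have "nat (b $ i mod D) \<le> nat (z $ i mod D)"
        by (rule b(2)[of "\<lambda>y. nat (y $ i mod D)"]) (use i in \<open>auto simp: G_def\<close>)
      moreover have "nat (D - b $ i mod D) \<le> nat (D - z $ i mod D)"
        by (rule b(2)[of "\<lambda>y. nat (D - y $ i mod D)"]) (use i in \<open>auto simp: G_def\<close>)
      moreover have "0 \<le> b $ i mod D" "0 \<le> z $ i mod D" "b $ i mod D < D" "z $ i mod D < D"
        using D0 by auto
      ultimately have "z $ i mod D = b $ i mod D" by linarith
      then show "D dvd (z - b) $ i" using dims i by (simp add: mod_eq_dvd_iff)
    qed
    moreover have "z = b + (z - b)" using dims by auto
    ultimately show ?thesis using b(1) by blast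
  qed
  have 2: "b + y \<in> X" if "b \<in> X" "y \<in> M" for b y
  proof -
    have dims: "b \<in> carrier_vec m" "y \<in> carrier_vec m" using that Xc Mc by auto
    have ly: "0 \<le> lin m l y" if "(l, c) \<in> Ls" for l c
      using \<open>y \<in> M\<close> that unfolding M_def by force
    have "d dvd lin m l y" if "(d, l, c) \<in> Ds" for d l c
      by (rule dvd_trans[OF Dd[OF that] dvd_lin]) (use \<open>y \<in> M\<close> in \<open>auto simp: M_def\<close>)
    then have dy: "d dvd lin m l b + lin m l y + c \<longleftrightarrow> d dvd lin m l b + c" if "(d, l, c) \<in> Ds" for d l c
      using that by (metis add.assoc add.commute dvd_add_left_iff)
    have "0 \<le> lin m l b + lin m l y + c" if "(l, c) \<in> Ls" for l c
      using ly[OF that] \<open>b \<in> X\<close> that unfolding X_def by fastforce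
    then show ?thesis using that dims dy unfolding X_def M_def
      by (auto simp: lin_add distrib_left)
  qed
  have "X = (\<Union>b\<in>B. (+) b ` M)" using 1 2 B(1) by blast
  then show ?thesis using that[of B P] B P Xc Mc by auto
qed

text \<open>The orthants of all sign patterns cover the lattice, \<open>N\<close> being the set of
  coordinates taken nonpositive; overlaps on coordinate hyperplanes are harmless in a union.\<close>

lemma int_system_semilinear:
  fixes Ls :: "((nat \<Rightarrow> int) \<times> int) set" and Ds :: "(int \<times> (nat \<Rightarrow> int) \<times> int) set" and m :: nat
  assumes fin: "finite Ls" "finite Ds"
    and Dpos: "\<And>d l b. (d, l, b) \<in> Ds \<Longrightarrow> d > 0"
  defines "X \<equiv> {z \<in> carrier_vec m. (\<forall>(l, b)\<in>Ls. 0 \<le> lin m l z + b) \<and>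
     (\<forall>(d, l, b)\<in>Ds. d dvd lin m l z + b)}"
  obtains BM where "finite BM" "\<And>b M. (b, M) \<in> BM \<Longrightarrow> b \<in> carrier_vec m \<and> fg_monoid m M"
    "X = (\<Union>(b, M)\<in>BM. (+) b ` M)"
proof -
  define s where "s N i = (if i \<in> N then - 1 else 1 :: int)" for N :: "nat set" and i
  define Y where "Y N = {z \<in> carrier_vec m. (\<forall>(l, b)\<in>Ls. 0 \<le> lin m l z + b) \<and>
     (\<forall>(d, l, b)\<in>Ds. d dvd lin m l z + b) \<and> (\<forall>i<m. 0 \<le> s N i * z $ i)}" for N
  have "\<exists>B P. finite B \<and> B \<subseteq> carrier_vec m \<and> finite P \<and> P \<subseteq> carrier_vec m \<and>
    Y N = (\<Union>b\<in>B. (+) b ` gen_monoid m P)" for N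
    by (rule int_system_orthant[OF fin, of "s N" m]) (auto simp: s_def Y_def Dpos)
  then obtain B P where BP: "\<And>N. finite (B N) \<and> B N \<subseteq> carrier_vec m \<and> finite (P N) \<and>
    P N \<subseteq> carrier_vec m \<and> Y N = (\<Union>b\<in>B N. (+) b ` gen_monoid m (P N))"
    by metis
  have "X = (\<Union>N\<in>Pow {..<m}. Y N)"
  proof (intro equalityI subsetI)
    fix z assume "z \<in> X"
    then have "z \<in> Y {i. i < m \<and> z $ i < 0}" unfolding X_def Y_def s_def by auto
    then show "z \<in> (\<Union>N\<in>Pow {..<m}. Y N)" by (intro UN_I) auto
  qed (auto simp: X_def Y_def)
  also have "\<dots> = (\<Union>(b, M)\<in>(\<Union>N\<in>Pow {..<m}. (\<lambda>b. (b, gen_monoid m (P N))) ` B N). (+) b ` M)"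
    using BP by auto
  finally show ?thesis
    by (rule that[rotated 2]) (use BP in \<open>auto simp: fg_monoid_def subset_iff\<close>)
qed


subsection \<open>Mixed sets and quantifier-free formulas\<close>

definition fin_inters :: "'a set set \<Rightarrow> 'a set set" where
  "fin_inters L = {\<Inter>K | K. finite K \<and> K \<subseteq> L}"

text \<open>Normal forms are kept as families of sets, so closure under Boolean operations takes the
  place of rewriting formulas.\<close>

definition dnf :: "'a set set \<Rightarrow> 'a set set" where
  "dnf L = {\<Union>F | F. finite F \<and> F \<subseteq> fin_inters L}"

lemma fin_inters_Int: "X \<in> fin_inters L \<Longrightarrow> Y \<in> fin_inters L \<Longrightarrow> X \<inter> Y \<in> fin_inters L"
  unfolding fin_inters_def
proof (elim CollectE exE conjE, intro CollectI)
  fix K K' assume "X = \<Inter>K" "Y = \<Inter>K'" "finite K" "K \<subseteq> L" "finite K'" "K' \<subseteq> L"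
  then show "\<exists>K. X \<inter> Y = \<Inter>K \<and> finite K \<and> K \<subseteq> L" by (intro exI[of _ "K \<union> K'"]) auto
qed

lemma dnf_fin_inters: "X \<in> fin_inters L \<Longrightarrow> X \<in> dnf L"
  unfolding dnf_def by (intro CollectI exI[of _ "{X}"]) auto

lemma dnf_lit: "X \<in> L \<Longrightarrow> X \<in> dnf L"
  by (rule dnf_fin_inters) (auto simp: fin_inters_def intro!: exI[of _ "{X}"])

lemma dnf_UNIV: "UNIV \<in> dnf L"
  by (rule dnf_fin_inters) (auto simp: fin_inters_def intro!: exI[of _ "{}"])

lemma dnf_empty: "{} \<in> dnf L"
  unfolding dnf_def by (intro CollectI exI[of _ "{}"]) auto

lemma dnf_Un: "X \<in> dnf L \<Longrightarrow> Y \<in> dnf L \<Longrightarrow> X \<union> Y \<in> dnf L"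
  unfolding dnf_def
proof (elim CollectE exE conjE, intro CollectI)
  fix F G assume "X = \<Union>F" "Y = \<Union>G" "finite F" "finite G" "F \<subseteq> fin_inters L" "G \<subseteq> fin_inters L"
  then show "\<exists>F. X \<union> Y = \<Union>F \<and> finite F \<and> F \<subseteq> fin_inters L" by (intro exI[of _ "F \<union> G"]) auto
qed

lemma dnf_UN: "finite I \<Longrightarrow> (\<And>i. i \<in> I \<Longrightarrow> X i \<in> dnf L) \<Longrightarrow> (\<Union>i\<in>I. X i) \<in> dnf L"
  by (induction I rule: finite_induct) (auto simp: dnf_empty intro: dnf_Un)

lemma dnf_Int: "X \<in> dnf L \<Longrightarrow> Y \<in> dnf L \<Longrightarrow> X \<inter> Y \<in> dnf L"
proof -
  assume "X \<in> dnf L" "Y \<in> dnf L"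
  then obtain F G where FG: "X = \<Union>F" "Y = \<Union>G" "finite F" "finite G"
    "F \<subseteq> fin_inters L" "G \<subseteq> fin_inters L"
    unfolding dnf_def by blast
  have "(\<Union>(U, V)\<in>F \<times> G. U \<inter> V) \<in> dnf L"
    using FG by (intro dnf_UN) (auto intro!: dnf_fin_inters fin_inters_Int)
  moreover have "X \<inter> Y = (\<Union>(U, V)\<in>F \<times> G. U \<inter> V)" using FG by auto
  ultimately show ?thesis by simp
qed

lemma dnf_INT: "finite I \<Longrightarrow> (\<And>i. i \<in> I \<Longrightarrow> X i \<in> dnf L) \<Longrightarrow> (\<Inter>i\<in>I. X i) \<in> dnf L"
  by (induction I rule: finite_induct) (auto simp: dnf_UNIV intro: dnf_Int)

text \<open>De Morgan reduces everything to complements of literals, and \<open>dnf_INT\<close>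
  distributes the resulting intersection of unions.\<close>

lemma dnf_Compl:
  assumes L: "\<And>X. X \<in> L \<Longrightarrow> - X \<in> dnf L" and X: "X \<in> dnf L"
  shows "- X \<in> dnf L"
proof -
  have *: "- Y \<in> dnf L" if Y: "Y \<in> fin_inters L" for Y
  proof -
    obtain K where K: "Y = \<Inter>K" "finite K" "K \<subseteq> L" using Y unfolding fin_inters_def by blast
    have "(\<Union>Z\<in>K. - Z) \<in> dnf L" using K L by (intro dnf_UN) auto
    moreover have "- Y = (\<Union>Z\<in>K. - Z)" using K by auto
    ultimately show ?thesis by simp
  qed
  obtain F where F: "X = \<Union>F" "finite F" "F \<subseteq> fin_inters L" using X unfolding dnf_def by blast
  have "(\<Inter>Y\<in>F. - Y) \<in> dnf L" using F * by (intro dnf_INT) auto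
  moreover have "- X = (\<Inter>Y\<in>F. - Y)" using F by auto
  ultimately show ?thesis by simp
qed

section \<open>Literals on the fractional and the integer part\<close>

definition rlin :: "nat \<Rightarrow> (nat \<Rightarrow> real) \<Rightarrow> real vec \<Rightarrow> real" where
  "rlin m k c = (\<Sum>i<m. k i * c $ i)"

text \<open>A pair \<open>(c, z)\<close> stands for the tuple \<open>c + z\<close> with fractional part \<open>c\<close> and integer part \<open>z\<close>.\<close>

inductive_set mixed_lits :: "nat \<Rightarrow> (real vec \<times> int vec) set set" for m where
  real: "R \<in> {(<), (\<le>), (=), (\<ge>), (>)} \<Longrightarrow>
    {p. R (rlin m (\<lambda>i. of_rat (k i)) (fst p)) (of_rat \<beta>)} \<in> mixed_lits m"
| nonneg: "{p. 0 \<le> lin m l (snd p) + b} \<in> mixed_lits m"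
| cong: "d > 0 \<Longrightarrow> {p. d dvd lin m l (snd p) + b} \<in> mixed_lits m"

abbreviation mixed :: "nat \<Rightarrow> (real vec \<times> int vec) set set" where
  "mixed m \<equiv> dnf (mixed_lits m)"

text \<open>A negated equation splits into two strict inequalities. For an integer x, the negation
  of 0 \<le> x is 0 \<le> - x - 1, and d fails to divide x exactly if it divides x + r for some
  shift r from 1 to d - 1.\<close>

lemma mixed_lits_Compl:
  assumes "X \<in> mixed_lits m"
  shows "- X \<in> mixed m"
  using assms
proof cases
  case (real R k \<beta>)
  have lit: "{p. R' (rlin m (\<lambda>i. of_rat (k i)) (fst p)) (of_rat \<beta>)} \<in> mixed m"
    if "R' \<in> {(<), (\<le>), (=), (\<ge>), (>)}" for R'
    using that by (intro dnf_lit mixed_lits.real)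
  note lits = lit[of "(<)", simplified] lit[of "(\<le>)", simplified] lit[of "(\<ge>)", simplified]
    lit[of "(>)", simplified]
  from real(2) consider "R = (<)" | "R = (\<le>)" | "R = (=)" | "R = (\<ge>)" | "R = (>)" by blast
  then show ?thesis
  proof cases
    case 1
    have "- X = {p. rlin m (\<lambda>i. of_rat (k i)) (fst p) \<ge> of_rat \<beta>}" unfolding real 1 by auto
    then show ?thesis using lits by simp
  next
    case 2
    have "- X = {p. rlin m (\<lambda>i. of_rat (k i)) (fst p) > of_rat \<beta>}" unfolding real 2 by auto
    then show ?thesis using lits by simp
  next
    case 3
    have "- X = {p. rlin m (\<lambda>i. of_rat (k i)) (fst p) > of_rat \<beta>} \<union>
      {p. rlin m (\<lambda>i. of_rat (k i)) (fst p) < of_rat \<beta>}" unfolding real 3 by auto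
    then show ?thesis using lits by (simp add: dnf_Un)
  next
    case 4
    have "- X = {p. rlin m (\<lambda>i. of_rat (k i)) (fst p) < of_rat \<beta>}" unfolding real 4 by auto
    then show ?thesis using lits by simp
  next
    case 5
    have "- X = {p. rlin m (\<lambda>i. of_rat (k i)) (fst p) \<le> of_rat \<beta>}" unfolding real 5 by auto
    then show ?thesis using lits by simp
  qed
next
  case (nonneg l b)
  have "{p. 0 \<le> lin m (\<lambda>i. - l i) (snd p) + (- b - 1)} \<in> mixed m"
    by (rule dnf_lit mixed_lits.nonneg)+
  moreover have "- X = {p. 0 \<le> lin m (\<lambda>i. - l i) (snd p) + (- b - 1)}"
    unfolding nonneg by (auto simp: lin_def sum_negf)
  ultimately show ?thesis by simp
next
  case (cong d l b)
  have "(\<Union>r\<in>{1..<d}. {p. d dvd lin m l (snd p) + (b + r)}) \<in> mixed m"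
    by (rule dnf_UN dnf_lit mixed_lits.cong finite_atLeastLessThan_int cong)+
  moreover have nd: "\<not> d dvd x \<longleftrightarrow> (\<exists>r\<in>{1..<d}. d dvd x + r)" for x
  proof
    assume "\<not> d dvd x"
    then have "0 < x mod d" using cong by (metis dvd_eq_mod_eq_0 le_less mod_int_pos_iff)
    moreover have "x mod d < d" using cong by simp
    moreover have "d dvd x + (d - x mod d)"
      by (metis add_diff_eq dvd_add_triv_right_iff dvd_minus_mod add.commute diff_add_eq)
    ultimately show "\<exists>r\<in>{1..<d}. d dvd x + r" by (intro bexI[of _ "d - x mod d"]) auto
  next
    assume "\<exists>r\<in>{1..<d}. d dvd x + r"
    then obtain r where r: "1 \<le> r" "r < d" "d dvd x + r" by auto
    then show "\<not> d dvd x" using zdvd_imp_le[of d r] by (auto simp: dvd_add_right_iff)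
  qed
  then have "- X = (\<Union>r\<in>{1..<d}. {p. d dvd lin m l (snd p) + (b + r)})"
    unfolding cong(1) Compl_eq Collect_mem_eq mem_Collect_eq nd by (auto simp: add.assoc)
  ultimately show ?thesis by simp
qed

lemma mixed_Compl: "X \<in> mixed m \<Longrightarrow> - X \<in> mixed m"
  by (rule dnf_Compl[OF mixed_lits_Compl])

text \<open>No dimension is imposed on the pairs, so that complements can be taken in the whole
  type; \<open>glue\<close> adds the carrier conditions.\<close>

definition cube_pairs :: "nat \<Rightarrow> (real vec \<times> int vec) set" where
  "cube_pairs m = {p. \<forall>i<m. 0 \<le> fst p $ i \<and> fst p $ i < 1}"

lemma mixed_rlin:
  assumes R: "R \<in> {(<), (\<le>), (=), (\<ge>), (>)}"
  shows "{p. R (rlin m (\<lambda>i. of_int (k i)) (fst p)) (of_int b)} \<in> mixed m"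
  using dnf_lit[OF mixed_lits.real[OF R, of m "\<lambda>i. of_int (k i)" "of_int b"]] by simp

lemma cube_pairs_mixed: "cube_pairs m \<in> mixed m"
proof -
  have *: "rlin m (\<lambda>j. of_int (if j = i then 1 else 0)) c = c $ i" if "i < m" for i c
  proof -
    have "rlin m (\<lambda>j. of_int (if j = i then 1 else 0)) c = (\<Sum>j<m. if j = i then c $ j else 0)"
      unfolding rlin_def by (intro sum.cong) auto
    with that show ?thesis by simp
  qed
  have "(\<Inter>i\<in>{..<m}. {p. rlin m (\<lambda>j. of_int (if j = i then 1 else 0)) (fst p) \<ge> of_int 0} \<inter>
     {p. rlin m (\<lambda>j. of_int (if j = i then 1 else 0)) (fst p) < of_int 1}) \<in> mixed m"
    by (rule dnf_INT dnf_Int mixed_rlin finite_lessThan | simp)+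
  also have "(\<Inter>i\<in>{..<m}. {p. rlin m (\<lambda>j. of_int (if j = i then 1 else 0)) (fst p) \<ge> of_int 0} \<inter>
     {p. rlin m (\<lambda>j. of_int (if j = i then 1 else 0)) (fst p) < of_int 1}) = cube_pairs m"
    using * unfolding cube_pairs_def by fastforce
  finally show ?thesis .
qed

lemma mixed_lin_less: "{p. lin m l (snd p) + a < 0} \<in> mixed m"
proof -
  have "{p. lin m l (snd p) + a < 0} = - {p. 0 \<le> lin m l (snd p) + a}" by auto
  also have "\<dots> \<in> mixed m" by (rule mixed_Compl dnf_lit mixed_lits.nonneg)+
  finally show ?thesis .
qed

text \<open>Literals require a positive modulus. Modulus 0 amounts to equality with 0, hence to two
  inequalities, and a negative modulus may be replaced by its absolute value.\<close>

lemma mixed_lin_dvd: "{p. d dvd lin m l (snd p) + a} \<in> mixed m"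
proof (cases "d = 0")
  case True
  have "{p :: real vec \<times> int vec. d dvd lin m l (snd p) + a} =
      - {p. lin m l (snd p) + a < 0} \<inter> - {p. lin m (\<lambda>i. - l i) (snd p) + - a < 0}"
    using True by (auto simp: lin_def sum_negf)
  then show ?thesis
    using dnf_Int[OF mixed_Compl[OF mixed_lin_less[of m l a]] mixed_Compl[OF mixed_lin_less[of m "\<lambda>i. - l i" "- a"]]]
    by (simp only:)
next
  case False
  then have "{p. \<bar>d\<bar> dvd lin m l (snd p) + a} \<in> mixed m" by (intro dnf_lit mixed_lits.cong) auto
  then show ?thesis by simp
qed

section \<open>Piecewise affine functions on the cube\<close>

text \<open>The pieces may overlap, since \<open>T\<close> agrees with the local function on each of
  them. They only have to cover the cube: outside it a floor could take infinitely many
  values.\<close>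

definition piecewise :: "nat \<Rightarrow> (real vec \<times> int vec \<Rightarrow> 'b) set \<Rightarrow> (real vec \<times> int vec \<Rightarrow> 'b) \<Rightarrow> bool" where
  "piecewise m S T \<longleftrightarrow> (\<exists>F. finite F \<and> (\<forall>(X, t)\<in>F. X \<in> mixed m \<and> t \<in> S \<and> (\<forall>p\<in>X. T p = t p)) \<and>
     (\<forall>p\<in>cube_pairs m. \<exists>X t. (X, t) \<in> F \<and> p \<in> X))"

lemma piecewise_base: "t \<in> S \<Longrightarrow> piecewise m S t"
  unfolding piecewise_def by (intro exI[of _ "{(UNIV, t)}"]) (auto simp: dnf_UNIV)

text \<open>An operation on a piecewise function may be studied one local function at a time: each
  piece of \<open>T\<close> is refined by the cover that belongs to its local function.\<close>

lemma piecewise_bind: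
  assumes T: "piecewise m S T" and g: "\<And>t. t \<in> S \<Longrightarrow> piecewise m S' (\<lambda>p. g p (t p))"
  shows "piecewise m S' (\<lambda>p. g p (T p))"
proof -
  obtain F where F: "finite F" "\<And>X t. (X, t) \<in> F \<Longrightarrow> X \<in> mixed m \<and> t \<in> S \<and> (\<forall>p\<in>X. T p = t p)"
    "\<And>p. p \<in> cube_pairs m \<Longrightarrow> \<exists>X t. (X, t) \<in> F \<and> p \<in> X" using T unfolding piecewise_def by fast
  define W where "W t G \<longleftrightarrow> finite G \<and>
     (\<forall>(X, u)\<in>G. X \<in> mixed m \<and> u \<in> S' \<and> (\<forall>p\<in>X. g p (t p) = u p)) \<and>
     (\<forall>p\<in>cube_pairs m. \<exists>X u. (X, u) \<in> G \<and> p \<in> X)"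
    for t :: "real vec \<times> int vec \<Rightarrow> 'a" and G
  have "\<forall>t\<in>S. \<exists>G. W t G" using g unfolding piecewise_def W_def by simp
  from bchoice[OF this] obtain G where "\<forall>t\<in>S. W t (G t)" ..
  then have W: "W t (G t)" if "t \<in> S" for t using that by simp
  have G: "\<And>t. t \<in> S \<Longrightarrow> finite (G t)"
    "\<And>t X u. t \<in> S \<Longrightarrow> (X, u) \<in> G t \<Longrightarrow> X \<in> mixed m \<and> u \<in> S' \<and> (\<forall>p\<in>X. g p (t p) = u p)"
    "\<And>t p. t \<in> S \<Longrightarrow> p \<in> cube_pairs m \<Longrightarrow> \<exists>X u. (X, u) \<in> G t \<and> p \<in> X"
    using W unfolding W_def by fastforce+
  define H where "H = (\<Union>(X, t)\<in>F. (\<lambda>(Y, u). (X \<inter> Y, u)) ` G t)"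
  have "finite H" unfolding H_def using F(1,2) G(1) by auto
  moreover have "Z \<in> mixed m \<and> u \<in> S' \<and> (\<forall>p\<in>Z. g p (T p) = u p)" if "(Z, u) \<in> H" for Z u
  proof -
    obtain X t Y where *: "(X, t) \<in> F" "(Y, u) \<in> G t" "Z = X \<inter> Y" using \<open>(Z, u) \<in> H\<close> unfolding H_def by auto
    with F(2)[OF *(1)] G(2)[of t Y u] show ?thesis by (auto intro: dnf_Int)
  qed
  moreover have "\<exists>Z u. (Z, u) \<in> H \<and> p \<in> Z" if p: "p \<in> cube_pairs m" for p
  proof -
    obtain X t where 1: "(X, t) \<in> F" "p \<in> X" using F(3)[OF p] by blast
    obtain Y u where 2: "(Y, u) \<in> G t" "p \<in> Y" using G(3)[OF _ p] F(2)[OF 1(1)] by blast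
    have "(X \<inter> Y, u) \<in> H" unfolding H_def using 1 2 by force
    then show ?thesis using 1 2 by blast
  qed
  ultimately show ?thesis unfolding piecewise_def by (intro exI[of _ H]) auto
qed

lemma piecewise_mixed:
  assumes T: "piecewise m S T" and P: "\<And>t. t \<in> S \<Longrightarrow> {p \<in> cube_pairs m. P (t p)} \<in> mixed m"
  shows "{p \<in> cube_pairs m. P (T p)} \<in> mixed m"
proof -
  obtain F where F: "finite F" "\<And>X t. (X, t) \<in> F \<Longrightarrow> X \<in> mixed m \<and> t \<in> S \<and> (\<forall>p\<in>X. T p = t p)"
    "\<And>p. p \<in> cube_pairs m \<Longrightarrow> \<exists>X t. (X, t) \<in> F \<and> p \<in> X" using T unfolding piecewise_def by fast
  have "(\<Union>(X, t)\<in>F. X \<inter> {p \<in> cube_pairs m. P (t p)}) \<in> mixed m"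
    using F P by (intro dnf_UN) (auto intro!: dnf_Int)
  moreover have "{p \<in> cube_pairs m. P (T p)} = (\<Union>(X, t)\<in>F. X \<inter> {p \<in> cube_pairs m. P (t p)})"
  proof (intro equalityI subsetI)
    fix p assume p: "p \<in> {p \<in> cube_pairs m. P (T p)}"
    then obtain X t where "(X, t) \<in> F" "p \<in> X" using F(3)[of p] by auto
    then show "p \<in> (\<Union>(X, t)\<in>F. X \<inter> {p \<in> cube_pairs m. P (t p)})"
      using p F(2) by (intro UN_I[of "(X, t)"]) auto
  next
    fix p assume "p \<in> (\<Union>(X, t)\<in>F. X \<inter> {p \<in> cube_pairs m. P (t p)})"
    then show "p \<in> {p \<in> cube_pairs m. P (T p)}" using F(2) by fastforce
  qed
  ultimately show ?thesis by simp
qed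

definition int_affine :: "nat \<Rightarrow> (real vec \<times> int vec \<Rightarrow> int) set" where
  "int_affine m = {t. \<exists>l a. t = (\<lambda>p. lin m l (snd p) + a)}"

text \<open>The two parts of a point carry independent coefficients because subtracting a floor
  changes only the part in \<open>snd p\<close> and the constant. That part is integer valued, so a
  floor can release it.\<close>

definition real_affine :: "nat \<Rightarrow> (real vec \<times> int vec \<Rightarrow> real) set" where
  "real_affine m = {t. \<exists>k l a. t = (\<lambda>p. rlin m (\<lambda>i. of_int (k i)) (fst p) + of_int (lin m l (snd p) + a))}"

abbreviation "pw_int m \<equiv> piecewise m (int_affine m)"
abbreviation "pw_real m \<equiv> piecewise m (real_affine m)"

lemma int_affine_of_int: "t \<in> int_affine m \<Longrightarrow> (\<lambda>p. of_int (t p)) \<in> real_affine m"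
proof -
  assume "t \<in> int_affine m"
  then obtain l a where "t = (\<lambda>p. lin m l (snd p) + a)" unfolding int_affine_def by blast
  then show ?thesis unfolding real_affine_def
    by (intro CollectI exI[of _ "\<lambda>_. 0"] exI[of _ l] exI[of _ a]) (auto simp: rlin_def)
qed

lemma real_affine_add:
  assumes "t \<in> real_affine m" "u \<in> real_affine m"
  shows "(\<lambda>p. t p + u p) \<in> real_affine m"
proof -
  obtain k l a k' l' a' where
    "t = (\<lambda>p. rlin m (\<lambda>i. of_int (k i)) (fst p) + of_int (lin m l (snd p) + a))"
    "u = (\<lambda>p. rlin m (\<lambda>i. of_int (k' i)) (fst p) + of_int (lin m l' (snd p) + a'))"
    using assms unfolding real_affine_def by blast
  then have "(\<lambda>p. t p + u p) = (\<lambda>p. rlin m (\<lambda>i. of_int (k i + k' i)) (fst p) +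
      of_int (lin m (\<lambda>i. l i + l' i) (snd p) + (a + a')))"
    by (auto simp: rlin_def lin_def sum.distrib algebra_simps)
  then show ?thesis unfolding real_affine_def mem_Collect_eq by (intro exI)
qed

lemma real_affine_mult:
  assumes "t \<in> real_affine m"
  shows "(\<lambda>p. of_int c * t p) \<in> real_affine m"
proof -
  obtain k l a where
    "t = (\<lambda>p. rlin m (\<lambda>i. of_int (k i)) (fst p) + of_int (lin m l (snd p) + a))"
    using assms unfolding real_affine_def by blast
  then have "(\<lambda>p. of_int c * t p) = (\<lambda>p. rlin m (\<lambda>i. of_int (c * k i)) (fst p) +
      of_int (lin m (\<lambda>i. c * l i) (snd p) + c * a))"
    by (auto simp: rlin_def lin_def sum_distrib_left algebra_simps)
  then show ?thesis unfolding real_affine_def mem_Collect_eq by (intro exI)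
qed

lemma real_affine_const: "(\<lambda>p. of_int c) \<in> real_affine m"
proof -
  have "(\<lambda>p. of_int c :: real) = (\<lambda>p::real vec \<times> int vec. rlin m (\<lambda>i. of_int 0) (fst p) + of_int (lin m (\<lambda>i. 0) (snd p) + c))"
    by (auto simp: rlin_def lin_def)
  then show ?thesis unfolding real_affine_def mem_Collect_eq by (intro exI)
qed

lemma real_affine_coord:
  assumes "i < m"
  shows "(\<lambda>p. fst p $ i + of_int (snd p $ i)) \<in> real_affine m"
proof -
  have "rlin m (\<lambda>j. of_int (if j = i then 1 else 0)) (fst p) +
      of_int (lin m (\<lambda>j. if j = i then 1 else 0) (snd p) + 0) = fst p $ i + of_int (snd p $ i)" for p
  proof -
    have "rlin m (\<lambda>j. of_int (if j = i then 1 else 0)) (fst p) = (\<Sum>j<m. if j = i then fst p $ j else 0)"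
      unfolding rlin_def by (intro sum.cong) auto
    moreover have "lin m (\<lambda>j. if j = i then 1 else 0) (snd p) = (\<Sum>j<m. if j = i then snd p $ j else 0)"
      unfolding lin_def by (intro sum.cong) auto
    ultimately show ?thesis using assms by simp
  qed
  then have "(\<lambda>p. fst p $ i + of_int (snd p $ i)) =
     (\<lambda>p. rlin m (\<lambda>j. of_int (if j = i then 1 else 0)) (fst p) +
      of_int (lin m (\<lambda>j. if j = i then 1 else 0) (snd p) + 0))" by (intro ext) (rule sym)
  then show ?thesis unfolding real_affine_def mem_Collect_eq by (intro exI)
qed

lemma pw_real_add: "pw_real m T \<Longrightarrow> pw_real m U \<Longrightarrow> pw_real m (\<lambda>p. T p + U p)"
  by (rule piecewise_bind, assumption, rule piecewise_bind, assumption)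
    (auto intro: piecewise_base real_affine_add)

lemma pw_real_mult: "pw_real m T \<Longrightarrow> pw_real m (\<lambda>p. of_int c * T p)"
  by (rule piecewise_bind, assumption) (auto intro: piecewise_base real_affine_mult)

lemma pw_real_neg: "pw_real m T \<Longrightarrow> pw_real m (\<lambda>p. - T p)"
  using pw_real_mult[of m T "- 1"] by simp

lemma pw_real_diff: "pw_real m T \<Longrightarrow> pw_real m U \<Longrightarrow> pw_real m (\<lambda>p. T p - U p)"
  using pw_real_add[of m T "\<lambda>p. - U p"] pw_real_neg[of m U] by simp

lemma pw_real_of_int: "pw_int m T \<Longrightarrow> pw_real m (\<lambda>p. of_int (T p))"
  by (rule piecewise_bind, assumption) (auto intro: piecewise_base int_affine_of_int)

text \<open>A linear form takes bounded values on the cube, so its floor takes finitely many.\<close>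

lemma pw_int_floor:
  assumes "pw_real m T"
  shows "pw_int m (\<lambda>p. \<lfloor>T p\<rfloor>)"
  using assms
proof (rule piecewise_bind)
  fix t assume "t \<in> real_affine m"
  then obtain k l a where t: "t = (\<lambda>p. rlin m (\<lambda>i. of_int (k i)) (fst p) + of_int (lin m l (snd p) + a))"
    unfolding real_affine_def by blast
  \<comment> \<open>Bounds the form on the cube, where the coordinates of \<open>fst p\<close> lie
    between 0 and 1; its floor is then one of \<open>- K..K\<close>.\<close>
  define K where "K = (\<Sum>i<m. \<bar>k i\<bar>)"
  define X where "X N = {p :: real vec \<times> int vec. rlin m (\<lambda>i. of_int (k i)) (fst p) \<ge> of_int N} \<inter>
    {p. rlin m (\<lambda>i. of_int (k i)) (fst p) < of_int (N + 1)}" for N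
  have X: "p \<in> X N \<longleftrightarrow> \<lfloor>rlin m (\<lambda>i. of_int (k i)) (fst p)\<rfloor> = N" for p :: "real vec \<times> int vec" and N
    unfolding X_def by (simp add: floor_eq_iff)
  have bound: "\<bar>rlin m (\<lambda>i. of_int (k i)) (fst p)\<bar> \<le> of_int K" if "p \<in> cube_pairs m" for p
  proof -
    have "\<bar>rlin m (\<lambda>i. of_int (k i)) (fst p)\<bar> \<le> (\<Sum>i<m. \<bar>of_int (k i) * fst p $ i\<bar>)"
      unfolding rlin_def by (rule sum_abs)
    also have "\<dots> \<le> (\<Sum>i<m. \<bar>of_int (k i)\<bar>)"
      using that unfolding cube_pairs_def by (intro sum_mono) (auto simp: abs_mult intro!: mult_left_le)
    finally show ?thesis unfolding K_def by simp
  qed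
  define F where "F = (\<lambda>N. (X N, \<lambda>p::real vec \<times> int vec. lin m l (snd p) + (a + N))) ` {- K..K}"
  have "finite F" unfolding F_def by simp
  moreover have "X' \<in> mixed m \<and> u \<in> int_affine m \<and> (\<forall>p\<in>X'. \<lfloor>t p\<rfloor> = u p)" if F: "(X', u) \<in> F" for X' u
  proof -
    obtain N where N: "X' = X N" "u = (\<lambda>p. lin m l (snd p) + (a + N))" using F unfolding F_def by auto
    have "X N \<in> mixed m" unfolding X_def by (intro dnf_Int mixed_rlin) auto
    moreover have "u \<in> int_affine m" unfolding N int_affine_def by blast
    moreover have "\<lfloor>t p\<rfloor> = u p" if "p \<in> X N" for p
    proof -
      have "\<lfloor>t p\<rfloor> = \<lfloor>rlin m (\<lambda>i. of_int (k i)) (fst p)\<rfloor> + (lin m l (snd p) + a)"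
        unfolding t by (metis floor_add_int)
      then show ?thesis using that X N by simp
    qed
    ultimately show ?thesis using N by simp
  qed
  moreover have "\<exists>X u. (X, u) \<in> F \<and> p \<in> X" if p: "p \<in> cube_pairs m" for p
  proof -
    let ?N = "\<lfloor>rlin m (\<lambda>i. of_int (k i)) (fst p)\<rfloor>"
    have "?N \<in> {- K..K}" using bound[OF p] by (auto simp: abs_le_iff le_floor_iff floor_le_iff)
    moreover have "p \<in> X ?N" by (simp add: X)
    ultimately show ?thesis unfolding F_def by blast
  qed
  ultimately show "pw_int m (\<lambda>p. \<lfloor>t p\<rfloor>)" unfolding piecewise_def
    by (intro exI[of _ F]) auto
qed

lemma pw_int_less: "pw_int m T \<Longrightarrow> {p \<in> cube_pairs m. T p < 0} \<in> mixed m"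
proof (erule piecewise_mixed)
  fix t assume "t \<in> int_affine m"
  then obtain l a where t: "t = (\<lambda>p. lin m l (snd p) + a)" unfolding int_affine_def by blast
  have "{p \<in> cube_pairs m. t p < 0} = cube_pairs m \<inter> {p. lin m l (snd p) + a < 0}" unfolding t by auto
  then show "{p \<in> cube_pairs m. t p < 0} \<in> mixed m"
    by (simp add: dnf_Int cube_pairs_mixed mixed_lin_less)
qed

lemma pw_int_dvd: "pw_int m T \<Longrightarrow> {p \<in> cube_pairs m. d dvd T p} \<in> mixed m"
proof (erule piecewise_mixed)
  fix t assume "t \<in> int_affine m"
  then obtain l a where t: "t = (\<lambda>p. lin m l (snd p) + a)" unfolding int_affine_def by blast
  have "{p \<in> cube_pairs m. d dvd t p} = cube_pairs m \<inter> {p. d dvd lin m l (snd p) + a}" unfolding t by auto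
  then show "{p \<in> cube_pairs m. d dvd t p} \<in> mixed m"
    by (simp add: dnf_Int cube_pairs_mixed mixed_lin_dvd)
qed

section \<open>Predicates given by mixed sets\<close>

definition mixed_pred :: "nat \<Rightarrow> (real vec \<times> int vec \<Rightarrow> bool) \<Rightarrow> bool" where
  "mixed_pred m P \<longleftrightarrow> {p \<in> cube_pairs m. P p} \<in> mixed m"

lemma mixed_pred_not: "mixed_pred m P \<Longrightarrow> mixed_pred m (\<lambda>p. \<not> P p)"
proof -
  assume "mixed_pred m P"
  then have "cube_pairs m \<inter> - {p \<in> cube_pairs m. P p} \<in> mixed m"
    unfolding mixed_pred_def by (intro dnf_Int cube_pairs_mixed mixed_Compl)
  moreover have "cube_pairs m \<inter> - {p \<in> cube_pairs m. P p} = {p \<in> cube_pairs m. \<not> P p}" by auto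
  ultimately show ?thesis unfolding mixed_pred_def by simp
qed

lemma mixed_pred_conj: "mixed_pred m P \<Longrightarrow> mixed_pred m Q \<Longrightarrow> mixed_pred m (\<lambda>p. P p \<and> Q p)"
proof -
  assume "mixed_pred m P" "mixed_pred m Q"
  then have "{p \<in> cube_pairs m. P p} \<inter> {p \<in> cube_pairs m. Q p} \<in> mixed m"
    unfolding mixed_pred_def by (rule dnf_Int)
  moreover have "{p \<in> cube_pairs m. P p} \<inter> {p \<in> cube_pairs m. Q p} = {p \<in> cube_pairs m. P p \<and> Q p}" by auto
  ultimately show ?thesis unfolding mixed_pred_def by simp
qed

lemma mixed_pred_disj:
  assumes "mixed_pred m P" "mixed_pred m Q"
  shows "mixed_pred m (\<lambda>p. P p \<or> Q p)"
proof -
  have "(\<lambda>p. P p \<or> Q p) = (\<lambda>p. \<not> (\<not> P p \<and> \<not> Q p))" by auto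
  moreover have "mixed_pred m (\<lambda>p. \<not> (\<not> P p \<and> \<not> Q p))"
    by (intro mixed_pred_not mixed_pred_conj assms)
  ultimately show ?thesis by simp
qed

lemma mixed_pred_imp: "mixed_pred m P \<Longrightarrow> mixed_pred m Q \<Longrightarrow> mixed_pred m (\<lambda>p. P p \<longrightarrow> Q p)"
  unfolding imp_conv_disj by (intro mixed_pred_disj mixed_pred_not)

lemma mixed_pred_iff: "mixed_pred m P \<Longrightarrow> mixed_pred m Q \<Longrightarrow> mixed_pred m (\<lambda>p. P p \<longleftrightarrow> Q p)"
  unfolding iff_conv_conj_imp by (intro mixed_pred_conj mixed_pred_imp)

text \<open>A real is negative exactly if its floor is, so a comparison of reals becomes an integer
  condition on each piece.\<close>

lemma mixed_pred_less: "pw_real m T \<Longrightarrow> mixed_pred m (\<lambda>p. T p < 0)"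
  using pw_int_less[OF pw_int_floor] unfolding mixed_pred_def by simp

lemma mixed_pred_le:
  assumes "pw_real m T"
  shows "mixed_pred m (\<lambda>p. T p \<le> 0)"
proof -
  have "(\<lambda>p. T p \<le> 0) = (\<lambda>p. \<not> - T p < 0)" by auto
  then show ?thesis using mixed_pred_not[OF mixed_pred_less[OF pw_real_neg[OF assms]]] by simp
qed

lemma mixed_pred_eq:
  assumes "pw_real m T"
  shows "mixed_pred m (\<lambda>p. T p = 0)"
proof -
  have "(\<lambda>p. T p = 0) = (\<lambda>p. T p \<le> 0 \<and> - T p \<le> 0)" by auto
  then show ?thesis
    using mixed_pred_conj[OF mixed_pred_le[OF assms] mixed_pred_le[OF pw_real_neg[OF assms]]] by simp
qed

lemma mixed_pred_rdvd:
  assumes "pw_real m T"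
  shows "mixed_pred m (\<lambda>p. of_int d rdvd T p)"
proof -
  have "mixed_pred m (\<lambda>p. d dvd \<lfloor>T p\<rfloor>)"
    using pw_int_dvd[OF pw_int_floor[OF assms]] unfolding mixed_pred_def .
  moreover have "mixed_pred m (\<lambda>p. of_int \<lfloor>T p\<rfloor> - T p = 0)"
    by (intro mixed_pred_eq pw_real_diff pw_real_of_int pw_int_floor assms)
  ultimately have "mixed_pred m (\<lambda>p. d dvd \<lfloor>T p\<rfloor> \<and> of_int \<lfloor>T p\<rfloor> - T p = 0)"
    by (rule mixed_pred_conj)
  then show ?thesis unfolding int_rdvd_real by simp
qed

text \<open>
  Nothing is known about the indices occurring in the output of the quantifier elimination, and
  \<open>nth\<close> beyond the end of a list is a junk value. So the environment is padded with zeros, and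
  the statements below hold for all large paddings.
\<close>

definition mixed_env :: "nat \<Rightarrow> nat \<Rightarrow> real vec \<times> int vec \<Rightarrow> real list" where
  "mixed_env m N p = map (\<lambda>i. if i < m then fst p $ i + of_int (snd p $ i) else 0) [0..<N]"

lemma pw_real_nth: "n < N \<Longrightarrow> pw_real m (\<lambda>p. mixed_env m N p ! n)"
  using real_affine_const[of 0 m]
  by (cases "n < m") (auto simp: mixed_env_def intro!: piecewise_base real_affine_coord)

text \<open>The filter merges the padding lengths demanded by the subterms: each index in
  \<open>t\<close> only asks the length to exceed it.\<close>

lemma pw_real_Inum: "\<forall>\<^sub>F N in sequentially. pw_real m (\<lambda>p. Inum (mixed_env m N p) t)"
proof (induction t)
  case (C c)
  show ?case by (simp add: piecewise_base real_affine_const)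
next
  case (Bound n)
  show ?case using eventually_gt_at_top[of n]
    by eventually_elim (simp add: pw_real_nth)
next
  case (CN n c t)
  then show ?case using eventually_gt_at_top[of n]
    by eventually_elim (simp add: pw_real_add pw_real_mult pw_real_nth)
next
  case (Neg t)
  then show ?case by eventually_elim (simp add: pw_real_neg)
next
  case (Add t u)
  then show ?case by eventually_elim (simp add: pw_real_add)
next
  case (Sub t u)
  then show ?case by eventually_elim (simp add: pw_real_diff)
next
  case (Mul c t)
  then show ?case by eventually_elim (simp add: pw_real_mult)
next
  case (Floor t)
  then show ?case by eventually_elim (simp add: pw_real_of_int pw_int_floor)
next
  case (CF c t u)
  then show ?case by eventually_elim (simp add: pw_real_add pw_real_mult pw_real_of_int pw_int_floor)
qed

lemma mixed_pred_Ifm: "qfree \<psi> \<Longrightarrow> \<forall>\<^sub>F N in sequentially. mixed_pred m (\<lambda>p. Ifm (mixed_env m N p) \<psi>)"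
proof (induction \<psi>)
  case T
  show ?case by (simp add: mixed_pred_def cube_pairs_mixed)
next
  case F
  show ?case by (simp add: mixed_pred_def dnf_empty)
next
  case (Lt t)
  show ?case using pw_real_Inum[of m t] by eventually_elim (simp add: mixed_pred_less)
next
  case (Le t)
  show ?case using pw_real_Inum[of m t] by eventually_elim (simp add: mixed_pred_le)
next
  case (Gt t)
  show ?case using pw_real_Inum[of m t]
    by eventually_elim (use mixed_pred_not[OF mixed_pred_le] in \<open>simp add: not_le\<close>)
next
  case (Ge t)
  show ?case using pw_real_Inum[of m t]
    by eventually_elim (use mixed_pred_not[OF mixed_pred_less] in \<open>simp add: not_less\<close>)
next
  case (Eq t)
  show ?case using pw_real_Inum[of m t] by eventually_elim (simp add: mixed_pred_eq)
next
  case (NEq t)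
  show ?case using pw_real_Inum[of m t] by eventually_elim (simp add: mixed_pred_eq mixed_pred_not)
next
  case (Dvd d t)
  show ?case using pw_real_Inum[of m t] by eventually_elim (simp add: mixed_pred_rdvd)
next
  case (NDvd d t)
  show ?case using pw_real_Inum[of m t] by eventually_elim (simp add: mixed_pred_rdvd mixed_pred_not)
next
  case (Not \<psi>)
  then have "\<forall>\<^sub>F N in sequentially. mixed_pred m (\<lambda>p. Ifm (mixed_env m N p) \<psi>)" by simp
  then show ?case by eventually_elim (simp add: mixed_pred_not)
next
  case (And \<psi> \<chi>)
  then have "\<forall>\<^sub>F N in sequentially. mixed_pred m (\<lambda>p. Ifm (mixed_env m N p) \<psi>)"
    "\<forall>\<^sub>F N in sequentially. mixed_pred m (\<lambda>p. Ifm (mixed_env m N p) \<chi>)" by simp_all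
  then show ?case by eventually_elim (simp add: mixed_pred_conj)
next
  case (Or \<psi> \<chi>)
  then have "\<forall>\<^sub>F N in sequentially. mixed_pred m (\<lambda>p. Ifm (mixed_env m N p) \<psi>)"
    "\<forall>\<^sub>F N in sequentially. mixed_pred m (\<lambda>p. Ifm (mixed_env m N p) \<chi>)" by simp_all
  then show ?case by eventually_elim (simp add: mixed_pred_disj)
next
  case (Imp \<psi> \<chi>)
  then have "\<forall>\<^sub>F N in sequentially. mixed_pred m (\<lambda>p. Ifm (mixed_env m N p) \<psi>)"
    "\<forall>\<^sub>F N in sequentially. mixed_pred m (\<lambda>p. Ifm (mixed_env m N p) \<chi>)" by simp_all
  then show ?case by eventually_elim (simp add: mixed_pred_imp)
next
  case (Iff \<psi> \<chi>)
  then have "\<forall>\<^sub>F N in sequentially. mixed_pred m (\<lambda>p. Ifm (mixed_env m N p) \<psi>)"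
    "\<forall>\<^sub>F N in sequentially. mixed_pred m (\<lambda>p. Ifm (mixed_env m N p) \<chi>)" by simp_all
  then show ?case by eventually_elim (simp add: mixed_pred_iff)
qed simp_all


subsection \<open>Definable sets are semi-polinear\<close>

lemma semi_polinear_UN:
  assumes "finite I" "\<And>i. i \<in> I \<Longrightarrow> semi_polinear n (X i)"
  shows "semi_polinear n (\<Union>i\<in>I. X i)"
proof -
  obtain F where F: "\<And>i. i \<in> I \<Longrightarrow> finite (F i) \<and> (\<forall>S\<in>F i. polinear n S) \<and> X i = \<Union>(F i)"
    using assms(2) unfolding semi_polinear_def by metis
  show ?thesis unfolding semi_polinear_def
    by (rule exI[of _ "\<Union>(F ` I)"]) (use F assms(1) in auto)
qed

lemma semi_polinear_polinear: "polinear n S \<Longrightarrow> semi_polinear n S"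
  unfolding semi_polinear_def by (intro exI[of _ "{S}"]) auto

lemma semi_polinear_empty: "semi_polinear n {}"
  unfolding semi_polinear_def by (intro exI[of _ "{}"]) auto

text \<open>A conjunction of literals sorted by the component it constrains, in the shapes used by
  \<open>polyhedral_convex\<close> and \<open>int_system_semilinear\<close>.\<close>

definition mixed_system ::
    "nat \<Rightarrow> (rat vec \<times> (real \<Rightarrow> real \<Rightarrow> bool) \<times> rat) list \<Rightarrow> ((nat \<Rightarrow> int) \<times> int) set \<Rightarrow>
     (int \<times> (nat \<Rightarrow> int) \<times> int) set \<Rightarrow> (real vec \<times> int vec) set \<Rightarrow> bool" where
  "mixed_system m cs Ls Ds X \<longleftrightarrow>
     (\<forall>(\<alpha>, R, \<beta>)\<in>set cs. \<alpha> \<in> carrier_vec m \<and> R \<in> {(<), (\<le>), (=), (\<ge>), (>)}) \<and>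
     finite Ls \<and> finite Ds \<and> (\<forall>d l b. (d, l, b) \<in> Ds \<longrightarrow> d > 0) \<and>
     (\<forall>c z. (c, z) \<in> X \<longleftrightarrow>
       (\<forall>(\<alpha>, R, \<beta>)\<in>set cs. R (\<Sum>i<m. of_rat (\<alpha> $ i) * c $ i) (of_rat \<beta>)) \<and>
       (\<forall>(l, b)\<in>Ls. 0 \<le> lin m l z + b) \<and> (\<forall>(d, l, b)\<in>Ds. d dvd lin m l z + b))"

lemma fin_inters_mixed_lits:
  assumes "X \<in> fin_inters (mixed_lits m)"
  shows "\<exists>cs Ls Ds. mixed_system m cs Ls Ds X"
proof -
  obtain K where K: "X = \<Inter>K" "finite K" "K \<subseteq> mixed_lits m" using assms unfolding fin_inters_def by blast
  show ?thesis using K(2,3) unfolding K(1)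
  proof (induction K rule: finite_induct)
    case empty
    have "mixed_system m [] {} {} (\<Inter>{})" unfolding mixed_system_def by simp
    then show ?case by blast
  next
    case (insert Y K)
    then obtain cs Ls Ds where IH: "mixed_system m cs Ls Ds (\<Inter>K)" by blast
    have "Y \<in> mixed_lits m" using insert by auto
    then show ?case
    proof cases
      case (real R k \<beta>)
      have "(c, z) \<in> Y \<longleftrightarrow> R (\<Sum>i<m. of_rat (vec m k $ i) * c $ i) (of_rat \<beta>)" for c and z :: "int vec"
      proof -
        have "(\<Sum>i<m. of_rat (vec m k $ i) * c $ i) = (\<Sum>i<m. of_rat (k i) * c $ i)"
          by (intro sum.cong) auto
        then show ?thesis unfolding real rlin_def by simp
      qed
      then have "mixed_system m ((vec m k, R, \<beta>) # cs) Ls Ds (\<Inter>(insert Y K))"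
        using IH real(2) unfolding mixed_system_def by simp
      then show ?thesis by blast
    next
      case (nonneg l b)
      then have "mixed_system m cs (insert (l, b) Ls) Ds (\<Inter>(insert Y K))"
        using IH unfolding mixed_system_def by auto
      then show ?thesis by blast
    next
      case (cong d l b)
      then have "mixed_system m cs Ls (insert (d, l, b) Ds) (\<Inter>(insert Y K))"
        using IH unfolding mixed_system_def by auto
      then show ?thesis by blast
    qed
  qed
qed

definition glue :: "(real vec \<times> int vec) set \<Rightarrow> nat \<Rightarrow> real vec set" where
  "glue X m = {c + map_vec real_of_int z | c z. c \<in> carrier_vec m \<and> z \<in> carrier_vec m \<and> (c, z) \<in> X}"

text \<open>Literals never relate the two components, so in dimension \<open>m\<close> the set
  \<open>X\<close> is a product of a polyhedral set \<open>C\<close> and a Presburger set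
  \<open>Z\<close>. Each translated monoid in \<open>Z\<close> contributes one polinear set.\<close>

lemma semi_polinear_glue_fin_inters:
  assumes X: "X \<in> fin_inters (mixed_lits m)" and sub: "X \<subseteq> cube_pairs m"
  shows "semi_polinear m (glue X m)"
\<comment> \<open>A polinear set needs a nonempty \<open>C\<close>, and \<open>C\<close> inherits
  the cube bounds from \<open>X\<close> only by being paired with some \<open>z0\<close> in
  \<open>Z\<close>.\<close>
proof (cases "glue X m = {}")
  case False
  obtain cs Ls Ds where "mixed_system m cs Ls Ds X" using fin_inters_mixed_lits[OF X] by blast
  then have *:
    "\<forall>(\<alpha>, R, \<beta>)\<in>set cs. \<alpha> \<in> carrier_vec m \<and> R \<in> {(<), (\<le>), (=), (\<ge>), (>)}"
    "finite Ls" "finite Ds" "\<And>d l b. (d, l, b) \<in> Ds \<Longrightarrow> d > 0"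
    "\<And>c z. (c, z) \<in> X \<longleftrightarrow> (\<forall>(\<alpha>, R, \<beta>)\<in>set cs. R (\<Sum>i<m. of_rat (\<alpha> $ i) * c $ i) (of_rat \<beta>)) \<and>
       (\<forall>(l, b)\<in>Ls. 0 \<le> lin m l z + b) \<and> (\<forall>(d, l, b)\<in>Ds. d dvd lin m l z + b)"
    unfolding mixed_system_def by blast+
  define C where "C = {c \<in> carrier_vec m. \<forall>(\<alpha>, R, \<beta>)\<in>set cs. R (\<Sum>i<m. of_rat (\<alpha> $ i) * c $ i) (of_rat \<beta>)}"
  define Z where "Z = {z \<in> carrier_vec m. (\<forall>(l, b)\<in>Ls. 0 \<le> lin m l z + b) \<and> (\<forall>(d, l, b)\<in>Ds. d dvd lin m l z + b)}"
  have CZ: "c \<in> carrier_vec m \<and> z \<in> carrier_vec m \<and> (c, z) \<in> X \<longleftrightarrow> c \<in> C \<and> z \<in> Z" for c z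
    unfolding *(5) C_def Z_def by auto
  obtain c0 z0 where c0: "c0 \<in> C" "z0 \<in> Z" using False CZ unfolding glue_def by auto
  have poly: "polyhedral_convex m C" unfolding polyhedral_convex_def C_def using *(1) by blast
  have "C \<subseteq> unit_cube m"
  proof
    fix c assume "c \<in> C"
    then have "c \<in> carrier_vec m" "(c, z0) \<in> cube_pairs m" using CZ c0 sub by blast+
    then show "c \<in> unit_cube m" unfolding cube_pairs_def unit_cube_def by auto
  qed
  obtain BM where BM: "finite BM" "\<And>b M. (b, M) \<in> BM \<Longrightarrow> b \<in> carrier_vec m \<and> fg_monoid m M"
    "Z = (\<Union>(b, M)\<in>BM. (+) b ` M)"
    by (rule int_system_semilinear[OF *(2,3), where m = m, folded Z_def])
      (erule *(4), rule that, assumption, blast, assumption)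
  have "glue X m = (\<Union>(b, M)\<in>BM. {c + map_vec real_of_int (b + z) | c z. c \<in> C \<and> z \<in> M})"
  proof -
    have "glue X m = {c + map_vec real_of_int z | c z. c \<in> C \<and> z \<in> Z}" unfolding glue_def using CZ by blast
    then show ?thesis unfolding BM(3) by auto blast
  qed
  moreover have pol: "polinear m {c + map_vec real_of_int (b + z) | c z. c \<in> C \<and> z \<in> M}" if "(b, M) \<in> BM" for b M
    unfolding polinear_def using poly c0(1) \<open>C \<subseteq> unit_cube m\<close> BM(2)[OF that]
    by (intro exI[of _ C] exI[of _ b] exI[of _ M]) auto
  have "semi_polinear m (\<Union>(b, M)\<in>BM. {c + map_vec real_of_int (b + z) | c z. c \<in> C \<and> z \<in> M})"
    by (intro semi_polinear_UN BM(1)) (auto intro: semi_polinear_polinear pol)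
  ultimately show ?thesis by simp
qed (simp add: semi_polinear_empty)

lemma semi_polinear_glue:
  assumes X: "X \<in> mixed m" and sub: "X \<subseteq> cube_pairs m"
  shows "semi_polinear m (glue X m)"
proof -
  obtain F where F: "finite F" "F \<subseteq> fin_inters (mixed_lits m)" "X = \<Union>F" using X unfolding dnf_def by blast
  have "glue X m = (\<Union>Y\<in>F. glue Y m)" unfolding glue_def F(3) by auto
  then show ?thesis
    using F sub by (auto intro!: semi_polinear_UN semi_polinear_glue_fin_inters)
qed

section \<open>Translation to de Bruijn formulas and elimination\<close>

text \<open>Variable \<open>i\<close> becomes the de Bruijn index \<open>\<pi> i\<close>.\<close>

primrec num_of_tm :: "(nat \<Rightarrow> nat) \<Rightarrow> tm \<Rightarrow> num" where
  "num_of_tm \<pi> (Var i) = Bound (\<pi> i)"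
| "num_of_tm \<pi> (Defs.Add s t) = MIR.Add (num_of_tm \<pi> s) (num_of_tm \<pi> t)"

text \<open>Under a quantifier all indices are lifted and the bound name is reassigned to 0, so a
  name that is bound again shadows correctly. Being an integer is divisibility by 1.\<close>

primrec mir_of_fm :: "Defs.fm \<Rightarrow> (nat \<Rightarrow> nat) \<Rightarrow> MIR.fm" where
  "mir_of_fm (Defs.Eq s t) \<pi> = MIR.Eq (Sub (num_of_tm \<pi> s) (num_of_tm \<pi> t))"
| "mir_of_fm (Defs.Le s t) \<pi> = MIR.Le (Sub (num_of_tm \<pi> s) (num_of_tm \<pi> t))"
| "mir_of_fm (IsInt t) \<pi> = Dvd 1 (num_of_tm \<pi> t)"
| "mir_of_fm (Defs.Neg \<phi>) \<pi> = MIR.Not (mir_of_fm \<phi> \<pi>)"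
| "mir_of_fm (Conj \<phi> \<psi>) \<pi> = MIR.And (mir_of_fm \<phi> \<pi>) (mir_of_fm \<psi> \<pi>)"
| "mir_of_fm (Exists i \<phi>) \<pi> = MIR.E (mir_of_fm \<phi> (\<lambda>j. if j = i then 0 else Suc (\<pi> j)))"

lemma Inum_num_of_tm: "Inum bs (num_of_tm \<pi> t) = tm_val (\<lambda>j. bs ! \<pi> j) t"
  by (induction t) auto

lemma Ifm_mir_of_fm: "Ifm bs (mir_of_fm \<phi> \<pi>) \<longleftrightarrow> sat (\<lambda>j. bs ! \<pi> j) \<phi>"
proof (induction \<phi> arbitrary: bs \<pi>)
  case (IsInt t)
  show ?case by (auto simp: Inum_num_of_tm rdvd_def Ints_def)
next
  case (Exists i \<phi>)
  have "(\<lambda>j. (r # bs) ! (if j = i then 0 else Suc (\<pi> j))) = (\<lambda>j. bs ! \<pi> j)(i := r)" for r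
    by auto
  then show ?case by (simp add: Exists.IH)
qed (auto simp: Inum_num_of_tm)

theorem definable_set_semi_polinear:
  assumes "definable_set m S"
  shows "semi_polinear m S"
proof -
  obtain \<phi> where S: "S = {v \<in> carrier_vec m. sat (\<lambda>i. if i < m then v $ i else 0) \<phi>}"
    using assms unfolding definable_set_def by blast
  \<comment> \<open>Variables from \<open>m\<close> on all go to index \<open>m\<close>, where the
    padded environment holds 0, in accordance with the default value in
    \<open>definable_set\<close>.\<close>
  define \<psi> where "\<psi> = mircfrqe (mir_of_fm \<phi> (\<lambda>j. min j m))"
  obtain N0 where N0: "\<forall>N\<ge>N0. mixed_pred m (\<lambda>p. Ifm (mixed_env m N p) \<psi>)"
    using mixed_pred_Ifm[of \<psi> m] mircfrqe unfolding \<psi>_def eventually_sequentially by blast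
  \<comment> \<open>\<open>N0\<close> serves the eliminated formula; \<open>Suc m\<close> puts index
    \<open>m\<close> inside the padded list.\<close>
  define N where "N = max N0 (Suc m)"
  have sat: "Ifm (mixed_env m N p) \<psi> \<longleftrightarrow> sat (\<lambda>i. if i < m then fst p $ i + of_int (snd p $ i) else 0) \<phi>" for p
  proof -
    have "(\<lambda>j. mixed_env m N p ! min j m) = (\<lambda>i. if i < m then fst p $ i + of_int (snd p $ i) else 0)"
      by (auto simp: mixed_env_def N_def min_def)
    then show ?thesis unfolding \<psi>_def mircfrqe[THEN conjunct1] Ifm_mir_of_fm by simp
  qed
  define X where "X = {p \<in> cube_pairs m. Ifm (mixed_env m N p) \<psi>}"
  have "semi_polinear m (glue X m)"
    by (rule semi_polinear_glue) (use N0 in \<open>auto simp: X_def N_def mixed_pred_def\<close>)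
  moreover have "glue X m = S"
  proof (intro equalityI subsetI)
    fix v assume "v \<in> glue X m"
    then obtain c z where v: "v = c + map_vec real_of_int z" "c \<in> carrier_vec m" "z \<in> carrier_vec m"
      "Ifm (mixed_env m N (c, z)) \<psi>"
      unfolding glue_def X_def by auto
    have "(\<lambda>i. if i < m then v $ i else 0) = (\<lambda>i. if i < m then c $ i + of_int (z $ i) else 0)"
      using v by auto
    then have "sat (\<lambda>i. if i < m then v $ i else 0) \<phi>" using v(4) unfolding sat fst_conv snd_conv by simp
    moreover have "v \<in> carrier_vec m" using v by simp
    ultimately show "v \<in> S" unfolding S by blast
  next
    fix v assume v: "v \<in> S"
    let ?c = "vec m (\<lambda>i. frac (v $ i))" and ?z = "vec m (\<lambda>i. \<lfloor>v $ i\<rfloor>)"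
    have "(\<lambda>i. if i < m then v $ i else 0) = (\<lambda>i. if i < m then ?c $ i + of_int (?z $ i) else 0)"
      by (auto simp: frac_def)
    then have "(?c, ?z) \<in> X" using v unfolding S X_def sat cube_pairs_def mem_Collect_eq fst_conv snd_conv
      by (simp add: frac_lt_1)
    moreover have "v = ?c + map_vec real_of_int ?z" using v unfolding S by (auto simp: frac_def)
    ultimately show "v \<in> glue X m" unfolding glue_def by fastforce
  qed
  ultimately show ?thesis by simp
qed


subsection \<open>Semi-polinear sets are definable\<close>

text \<open>Free variables are left unrestricted, which makes the closure rules uniform;
  \<open>definable_set_iff\<close> gets rid of surplus ones.\<close>

definition definable_pred :: "((nat \<Rightarrow> real) \<Rightarrow> bool) \<Rightarrow> bool" where
  "definable_pred P \<longleftrightarrow> (\<exists>\<phi>. \<forall>e. sat e \<phi> \<longleftrightarrow> P e)"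

lemma definable_pred_not: "definable_pred P \<Longrightarrow> definable_pred (\<lambda>e. \<not> P e)"
  unfolding definable_pred_def by (metis sat.simps(4))

lemma definable_pred_conj: "definable_pred P \<Longrightarrow> definable_pred Q \<Longrightarrow> definable_pred (\<lambda>e. P e \<and> Q e)"
  unfolding definable_pred_def by (metis sat.simps(5))

lemma definable_pred_ex: "definable_pred P \<Longrightarrow> definable_pred (\<lambda>e. \<exists>r. P (e(i := r)))"
  unfolding definable_pred_def by (metis sat.simps(6))

lemma definable_pred_disj:
  assumes "definable_pred P" "definable_pred Q"
  shows "definable_pred (\<lambda>e. P e \<or> Q e)"
proof -
  have "definable_pred (\<lambda>e. \<not> (\<not> P e \<and> \<not> Q e))"
    by (intro definable_pred_not definable_pred_conj assms)
  then show ?thesis by simp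
qed

lemma definable_pred_le_var: "definable_pred (\<lambda>e. e i \<le> e j)"
  unfolding definable_pred_def by (rule exI[of _ "Defs.Le (Var i) (Var j)"]) simp

lemma definable_pred_eq_var: "definable_pred (\<lambda>e. e i = e j)"
  unfolding definable_pred_def by (rule exI[of _ "Defs.Eq (Var i) (Var j)"]) simp

lemma definable_pred_eq_add_var: "definable_pred (\<lambda>e. e i = e j + e k)"
  unfolding definable_pred_def by (rule exI[of _ "Defs.Eq (Var i) (Defs.Add (Var j) (Var k))"]) simp

lemma definable_pred_int_var: "definable_pred (\<lambda>e. e i \<in> \<int>)"
  unfolding definable_pred_def by (rule exI[of _ "IsInt (Var i)"]) simp

lemma definable_pred_const: "definable_pred (\<lambda>e. b)"
proof -
  have "definable_pred (\<lambda>e. e 0 = e 0)" by (rule definable_pred_eq_var)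
  then show ?thesis using definable_pred_not[of "\<lambda>_. True"] by (cases b) auto
qed

lemma definable_pred_ball:
  assumes "finite I" "\<And>i. i \<in> I \<Longrightarrow> definable_pred (P i)"
  shows "definable_pred (\<lambda>e. \<forall>i\<in>I. P i e)"
  using assms by (induction I rule: finite_induct) (auto simp: definable_pred_const intro: definable_pred_conj)

lemma definable_pred_bex:
  assumes "finite I" "\<And>i. i \<in> I \<Longrightarrow> definable_pred (P i)"
  shows "definable_pred (\<lambda>e. \<exists>i\<in>I. P i e)"
  using assms by (induction I rule: finite_induct) (auto simp: definable_pred_const intro: definable_pred_disj)

lemma definable_pred_all_less:
  "(\<And>i. i < n \<Longrightarrow> definable_pred (P i)) \<Longrightarrow> definable_pred (\<lambda>e. \<forall>i<n. P i e)" for n :: nat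
  using definable_pred_ball[of "{..<n}" P] by (simp add: Ball_def)

text \<open>The variable \<open>y\<close> may even be one on which \<open>g\<close> depends. Finite
  support guarantees fresh variables when values are composed.\<close>

definition definable_val :: "((nat \<Rightarrow> real) \<Rightarrow> real) \<Rightarrow> bool" where
  "definable_val g \<longleftrightarrow> (\<exists>N. \<forall>e e'. (\<forall>i<N. e i = e' i) \<longrightarrow> g e = g e') \<and>
     (\<forall>y. definable_pred (\<lambda>e. e y = g e))"

lemma definable_val_support:
  assumes "definable_val g"
  obtains N where "\<And>i e r. i \<ge> N \<Longrightarrow> g (e(i := r)) = g e"
proof -
  obtain N where "\<forall>e e'. (\<forall>i<N. e i = e' i) \<longrightarrow> g e = g e'" using assms unfolding definable_val_def by blast
  then have "g (e(i := r)) = g e" if "i \<ge> N" for i e r using that by simp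
  then show ?thesis using that by blast
qed

text \<open>Two quantified variables name the values of \<open>g\<close> and \<open>h\<close>. They
  are chosen beyond both supports and different from \<open>y\<close>, so assigning them changes
  nothing else.\<close>

lemma definable_pred_subst:
  assumes g: "definable_val g" and h: "definable_val h"
    and R: "\<And>a b. definable_pred (\<lambda>e. R (e y) (e a) (e b))"
  shows "definable_pred (\<lambda>e. R (e y) (g e) (h e))"
proof -
  obtain N1 where N1: "\<And>i e r. i \<ge> N1 \<Longrightarrow> g (e(i := r)) = g e" using definable_val_support[OF g] by blast
  obtain N2 where N2: "\<And>i e r. i \<ge> N2 \<Longrightarrow> h (e(i := r)) = h e" using definable_val_support[OF h] by blast
  define a where "a = Suc (N1 + N2 + y)"
  define b where "b = Suc a"
  have "definable_pred (\<lambda>e. \<exists>r. \<exists>s.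
      (e(a := r, b := s)) a = g (e(a := r, b := s)) \<and> (e(a := r, b := s)) b = h (e(a := r, b := s)) \<and>
      R ((e(a := r, b := s)) y) ((e(a := r, b := s)) a) ((e(a := r, b := s)) b))"
    by (intro definable_pred_ex[where P = "\<lambda>e. \<exists>s. P (e(b := s))" for P] definable_pred_ex definable_pred_conj R)
      (use g h in \<open>auto simp: definable_val_def\<close>)
  moreover have "a \<noteq> b" "y \<noteq> a" "y \<noteq> b" "a \<ge> N1" "b \<ge> N1" "a \<ge> N2" "b \<ge> N2"
    unfolding a_def b_def by auto
  ultimately show ?thesis by (simp add: N1 N2)
qed

lemma definable_pred_rel:
  assumes "definable_val g" "definable_val h"
    and "\<And>a b. definable_pred (\<lambda>e. R (e a) (e b))"
  shows "definable_pred (\<lambda>e. R (g e) (h e))"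
  using definable_pred_subst[of g h "\<lambda>_. R"] assms by blast

lemma definable_val_op:
  assumes g: "definable_val g" and h: "definable_val h"
    and R: "\<And>y a b. definable_pred (\<lambda>e. e y = f (e a) (e b))"
  shows "definable_val (\<lambda>e. f (g e) (h e))"
proof -
  obtain N1 N2 where "\<forall>e e'. (\<forall>i<N1. e i = e' i) \<longrightarrow> g e = g e'" "\<forall>e e'. (\<forall>i<N2. e i = e' i) \<longrightarrow> h e = h e'"
    using g h unfolding definable_val_def by blast
  then have "\<forall>e e'. (\<forall>i<max N1 N2. e i = e' i) \<longrightarrow> f (g e) (h e) = f (g e') (h e')"
    by (metis max.strict_coboundedI1 max.strict_coboundedI2)
  moreover have "definable_pred (\<lambda>e. e y = f (g e) (h e))" for y
    using definable_pred_subst[OF g h, of "\<lambda>u v w. u = f v w" y] R by blast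
  ultimately show ?thesis unfolding definable_val_def by blast
qed

lemma definable_val_var: "definable_val (\<lambda>e. e i)"
  unfolding definable_val_def using definable_pred_eq_var[of _ i] by (auto intro: exI[of _ "Suc i"])

lemma definable_val_zero: "definable_val (\<lambda>e. 0)"
proof -
  have "definable_pred (\<lambda>e. e y = e y + e y)" for y by (rule definable_pred_eq_add_var)
  then show ?thesis unfolding definable_val_def by simp
qed

lemma definable_val_add: "definable_val g \<Longrightarrow> definable_val h \<Longrightarrow> definable_val (\<lambda>e. g e + h e)"
  by (rule definable_val_op[where f = "(+)"]) (auto intro: definable_pred_eq_add_var)

lemma definable_pred_eq: "definable_val g \<Longrightarrow> definable_val h \<Longrightarrow> definable_pred (\<lambda>e. g e = h e)"
  by (rule definable_pred_rel[where R = "(=)"]) (auto intro: definable_pred_eq_var)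

lemma definable_pred_le: "definable_val g \<Longrightarrow> definable_val h \<Longrightarrow> definable_pred (\<lambda>e. g e \<le> h e)"
  by (rule definable_pred_rel[where R = "(\<le>)"]) (auto intro: definable_pred_le_var)

lemma definable_pred_less: "definable_val g \<Longrightarrow> definable_val h \<Longrightarrow> definable_pred (\<lambda>e. g e < h e)"
  using definable_pred_not[OF definable_pred_le[of h g]] by (simp add: not_le)

lemma definable_pred_int: "definable_val g \<Longrightarrow> definable_pred (\<lambda>e. g e \<in> \<int>)"
  using definable_pred_rel[of g g "\<lambda>x _. x \<in> \<int>"] definable_pred_int_var by blast

lemma definable_val_diff:
  assumes "definable_val g" "definable_val h"
  shows "definable_val (\<lambda>e. g e - h e)"
proof (rule definable_val_op[OF assms])
  fix y a b
  have "definable_pred (\<lambda>e. e a = e y + e b)" by (rule definable_pred_eq_add_var)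
  moreover have "(\<lambda>e :: nat \<Rightarrow> real. e a = e y + e b) = (\<lambda>e. e y = e a - e b)" by auto
  ultimately show "definable_pred (\<lambda>e. e y = e a - e b)" by simp
qed

text \<open>The number 1 is the least positive integer.\<close>

lemma definable_val_one: "definable_val (\<lambda>e. 1)"
proof -
  have "definable_pred (\<lambda>e. e y = 1)" for y
  proof -
    have "definable_pred (\<lambda>e. e y \<in> \<int> \<and> 0 < e y \<and>
        \<not> (\<exists>r. (e(Suc y := r)) (Suc y) \<in> \<int> \<and> 0 < (e(Suc y := r)) (Suc y) \<and> (e(Suc y := r)) (Suc y) < (e(Suc y := r)) y))"
      by (intro definable_pred_conj definable_pred_not definable_pred_ex definable_pred_int
          definable_pred_less definable_val_var definable_val_zero)
    also have "(\<lambda>e. e y \<in> \<int> \<and> 0 < e y \<and>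
        \<not> (\<exists>r. (e(Suc y := r)) (Suc y) \<in> \<int> \<and> 0 < (e(Suc y := r)) (Suc y) \<and> (e(Suc y := r)) (Suc y) < (e(Suc y := r)) y)) =
        (\<lambda>e :: nat \<Rightarrow> real. e y = 1)"
    proof (intro ext iffI)
      fix e :: "nat \<Rightarrow> real"
      assume e: "e y \<in> \<int> \<and> 0 < e y \<and>
        \<not> (\<exists>r. (e(Suc y := r)) (Suc y) \<in> \<int> \<and> 0 < (e(Suc y := r)) (Suc y) \<and> (e(Suc y := r)) (Suc y) < (e(Suc y := r)) y)"
      then have "\<not> 1 < e y" using Ints_1 by fastforce
      moreover obtain k where "e y = of_int k" using e Ints_cases by metis
      ultimately show "e y = 1" using e by simp
    next
      fix e :: "nat \<Rightarrow> real"
      assume "e y = 1"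
      moreover have "\<not> (r \<in> \<int> \<and> 0 < r \<and> r < 1)" for r :: real by (auto elim!: Ints_cases)
      ultimately show "e y \<in> \<int> \<and> 0 < e y \<and>
        \<not> (\<exists>r. (e(Suc y := r)) (Suc y) \<in> \<int> \<and> 0 < (e(Suc y := r)) (Suc y) \<and> (e(Suc y := r)) (Suc y) < (e(Suc y := r)) y)"
        by simp
    qed
    finally show ?thesis .
  qed
  then show ?thesis unfolding definable_val_def by simp
qed

lemma definable_val_of_nat_mult: "definable_val g \<Longrightarrow> definable_val (\<lambda>e. of_nat k * g e)"
  by (induction k) (auto simp: definable_val_zero distrib_right intro!: definable_val_add)

lemma definable_val_of_int_mult:
  assumes "definable_val g"
  shows "definable_val (\<lambda>e. of_int k * g e)"
proof (cases "k \<ge> 0")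
  case True
  then show ?thesis using definable_val_of_nat_mult[OF assms, of "nat k"] by simp
next
  case False
  then have "(\<lambda>e. of_int k * g e) = (\<lambda>e. 0 - of_nat (nat (- k)) * g e)" by auto
  then show ?thesis
    using definable_val_diff[OF definable_val_zero definable_val_of_nat_mult[OF assms]] by simp
qed

lemma definable_val_of_rat_mult:
  assumes "definable_val g"
  shows "definable_val (\<lambda>e. of_rat r * g e)"
proof -
  obtain a b where r: "r = Fract a b" "b > 0" by (cases r) auto
  show ?thesis
  \<comment> \<open>A unary operation is passed as a binary one with a dummy second argument. With r
    = a / b, the equation y = r x is cleared to b y = a x.\<close>
  proof (rule definable_val_op[OF assms assms, where f = "\<lambda>x _. of_rat r * x"])
    fix y x z
    have "definable_pred (\<lambda>e. of_int b * e y = of_int a * e x)"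
      by (intro definable_pred_eq definable_val_of_int_mult definable_val_var)
    moreover have "(\<lambda>e. of_int b * e y = of_int a * e x) = (\<lambda>e :: nat \<Rightarrow> real. e y = of_rat r * e x)"
      using r by (auto simp: of_rat_rat field_simps)
    ultimately show "definable_pred (\<lambda>e. e y = of_rat r * e x)" by simp
  qed
qed

lemma definable_val_of_rat: "definable_val (\<lambda>e. of_rat r)"
  using definable_val_of_rat_mult[OF definable_val_one, of r] by simp

lemma definable_val_sum:
  "finite I \<Longrightarrow> (\<And>i. i \<in> I \<Longrightarrow> definable_val (g i)) \<Longrightarrow> definable_val (\<lambda>e. \<Sum>i\<in>I. g i e)"
  by (induction I rule: finite_induct) (auto simp: definable_val_zero intro: definable_val_add)

lemma definable_val_floor:
  assumes "definable_val g"
  shows "definable_val (\<lambda>e. of_int \<lfloor>g e\<rfloor>)"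
proof (rule definable_val_op[OF assms assms, where f = "\<lambda>x _. of_int \<lfloor>x\<rfloor>"])
  fix y x z
  have "definable_pred (\<lambda>e. e y \<in> \<int> \<and> e y \<le> e x \<and> e x < e y + 1)"
    by (intro definable_pred_conj definable_pred_int definable_pred_le definable_pred_less
        definable_val_add definable_val_one definable_val_var)
  moreover have "(\<lambda>e. e y \<in> \<int> \<and> e y \<le> e x \<and> e x < e y + 1) = (\<lambda>e :: nat \<Rightarrow> real. e y = of_int \<lfloor>e x\<rfloor>)"
  proof (intro ext iffI)
    fix e :: "nat \<Rightarrow> real"
    assume e: "e y \<in> \<int> \<and> e y \<le> e x \<and> e x < e y + 1"
    then obtain k where k: "e y = of_int k" using Ints_cases by metis
    with e have "\<lfloor>e x\<rfloor> = k" by (intro floor_unique) auto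
    with k show "e y = of_int \<lfloor>e x\<rfloor>" by simp
  qed (auto intro: floor_correct)
  ultimately show "definable_pred (\<lambda>e. e y = of_int \<lfloor>e x\<rfloor>)" by simp
qed

lemma definable_val_frac: "definable_val g \<Longrightarrow> definable_val (\<lambda>e. frac (g e))"
  unfolding frac_def by (intro definable_val_diff definable_val_floor)

lemma definable_pred_order:
  assumes "R \<in> {(<), (\<le>), (=), (\<ge>), (>)}" "definable_val g" "definable_val h"
  shows "definable_pred (\<lambda>e. R (g e) (h e))"
  using assms by (auto intro: definable_pred_less definable_pred_le definable_pred_eq)

section \<open>Free variables and blocks of quantifiers\<close>

lemma tm_val_cong: "(\<And>i. i \<in> tm_vars t \<Longrightarrow> e i = e' i) \<Longrightarrow> tm_val e t = tm_val e' t"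
  by (induction t) auto

lemma sat_cong: "(\<And>i. i \<in> free_vars \<phi> \<Longrightarrow> e i = e' i) \<Longrightarrow> sat e \<phi> \<longleftrightarrow> sat e' \<phi>"
proof (induction \<phi> arbitrary: e e')
  case (Exists i \<phi>)
  have "sat (e(i := r)) \<phi> \<longleftrightarrow> sat (e'(i := r)) \<phi>" for r
    using Exists.prems by (intro Exists.IH) auto
  then show ?case by simp
next
  case (Conj \<phi> \<psi>)
  have "sat e \<phi> \<longleftrightarrow> sat e' \<phi>" "sat e \<psi> \<longleftrightarrow> sat e' \<psi>"
    using Conj.prems by (auto intro!: Conj.IH)
  then show ?case by simp
next
  case (Neg \<phi>)
  have "sat e \<phi> \<longleftrightarrow> sat e' \<phi>" using Neg.prems by (intro Neg.IH) auto
  then show ?case by simp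
next
  case (Eq s t)
  then show ?case using tm_val_cong[of s e e'] tm_val_cong[of t e e'] by simp
next
  case (Le s t)
  then show ?case using tm_val_cong[of s e e'] tm_val_cong[of t e e'] by simp
next
  case (IsInt t)
  then show ?case using tm_val_cong[of t e e'] by simp
qed

lemma free_vars_foldr_Exists: "free_vars (foldr Exists xs \<phi>) = free_vars \<phi> - set xs"
  by (induction xs) auto

lemma sat_foldr_Exists: "sat e (foldr Exists xs \<phi>) \<longleftrightarrow> (\<exists>e'. (\<forall>i. i \<notin> set xs \<longrightarrow> e' i = e i) \<and> sat e' \<phi>)"
proof (induction xs arbitrary: e)
  case Nil
  have "e' = e" if "\<forall>i. e' i = e i" for e' :: "nat \<Rightarrow> real" using that by auto
  then show ?case by auto
next
  case (Cons x xs)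
  show ?case
  proof
    assume "sat e (foldr Exists (x # xs) \<phi>)"
    then obtain r e' where "\<forall>i. i \<notin> set xs \<longrightarrow> e' i = (e(x := r)) i" "sat e' \<phi>"
      using Cons.IH by auto
    then show "\<exists>e'. (\<forall>i. i \<notin> set (x # xs) \<longrightarrow> e' i = e i) \<and> sat e' \<phi>"
      by (intro exI[of _ e']) auto
  next
    assume "\<exists>e'. (\<forall>i. i \<notin> set (x # xs) \<longrightarrow> e' i = e i) \<and> sat e' \<phi>"
    then obtain e' where e': "\<forall>i. i \<notin> set (x # xs) \<longrightarrow> e' i = e i" "sat e' \<phi>" by auto
    then have "sat (e(x := e' x)) (foldr Exists xs \<phi>)" unfolding Cons.IH
      by (intro exI[of _ e']) auto
    then show "sat e (foldr Exists (x # xs) \<phi>)" by auto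
  qed
qed

lemma definable_pred_ex_finite:
  assumes "definable_pred P" "finite I"
  shows "definable_pred (\<lambda>e. \<exists>e'. (\<forall>i. i \<notin> I \<longrightarrow> e' i = e i) \<and> P e')"
proof -
  obtain \<phi> where "\<forall>e. sat e \<phi> \<longleftrightarrow> P e" using assms(1) unfolding definable_pred_def by blast
  moreover obtain xs where "set xs = I" using finite_list[OF assms(2)] by blast
  ultimately show ?thesis unfolding definable_pred_def
    by (intro exI[of _ "foldr Exists xs \<phi>"]) (simp add: sat_foldr_Exists)
qed

lemma finite_tm_vars: "finite (tm_vars t)"
  by (induction t) auto

lemma finite_free_vars: "finite (free_vars \<phi>)"
  by (induction \<phi>) (auto simp: finite_tm_vars)

text \<open>Free variables from \<open>m\<close> on cannot affect the truth value, because
  \<open>vec m e\<close> reads only the first \<open>m\<close> values; binding them existentially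
  removes them.\<close>

lemma definable_set_iff:
  "definable_set m S \<longleftrightarrow> S \<subseteq> carrier_vec m \<and> definable_pred (\<lambda>e. vec m e \<in> S)"
proof
  assume "definable_set m S"
  then obtain \<phi> where \<phi>: "free_vars \<phi> \<subseteq> {..<m}"
    "S = {v \<in> carrier_vec m. sat (\<lambda>i. if i < m then v $ i else 0) \<phi>}"
    unfolding definable_set_def by blast
  have "sat e \<phi> \<longleftrightarrow> vec m e \<in> S" for e
  proof -
    have "sat (\<lambda>i. if i < m then vec m e $ i else 0) \<phi> \<longleftrightarrow> sat e \<phi>"
      by (rule sat_cong) (use \<phi>(1) in auto)
    then show ?thesis unfolding \<phi>(2) by simp
  qed
  then show "S \<subseteq> carrier_vec m \<and> definable_pred (\<lambda>e. vec m e \<in> S)"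
    unfolding definable_pred_def using \<phi>(2) by auto
next
  assume S: "S \<subseteq> carrier_vec m \<and> definable_pred (\<lambda>e. vec m e \<in> S)"
  then obtain \<phi> where \<phi>: "\<And>e. sat e \<phi> \<longleftrightarrow> vec m e \<in> S" unfolding definable_pred_def by blast
  obtain xs where xs: "set xs = free_vars \<phi> - {..<m}"
    using finite_list[of "free_vars \<phi> - {..<m}"] finite_free_vars by blast
  have "sat e (foldr Exists xs \<phi>) \<longleftrightarrow> vec m e \<in> S" for e
  proof -
    have "vec m e' = vec m e" if "\<forall>i. i \<notin> set xs \<longrightarrow> e' i = e i" for e'
      using that xs by (intro eq_vecI) auto
    then show ?thesis unfolding sat_foldr_Exists \<phi> by metis
  qed
  moreover have "vec m (\<lambda>i. if i < m then v $ i else 0) = v" if "v \<in> carrier_vec m" for v :: "real vec"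
    using that by (intro eq_vecI) auto
  ultimately show "definable_set m S" unfolding definable_set_def
    by (intro exI[of _ "foldr Exists xs \<phi>"]) (use S xs in \<open>auto simp: free_vars_foldr_Exists\<close>)
qed

section \<open>Definability of monoids and polinear sets\<close>

lemma gen_monoid_empty: "gen_monoid m {} = {0\<^sub>v m}"
  unfolding gen_monoid_def by auto

text \<open>Splits off one generator together with its multiplicity, the quantity over which the
  defining formula quantifies.\<close>

lemma gen_monoid_insert:
  assumes "p \<in> carrier_vec m" "P \<subseteq> carrier_vec m"
  shows "gen_monoid m (insert p P) = {int k \<cdot>\<^sub>v p + w | k w. w \<in> gen_monoid m P}"
proof (intro equalityI subsetI)
  fix z assume "z \<in> gen_monoid m (insert p P)"
  then show "z \<in> {int k \<cdot>\<^sub>v p + w | k w. w \<in> gen_monoid m P}"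
  proof (induction rule: gen_monoid_induct)
    case zero
    have "0\<^sub>v m = int 0 \<cdot>\<^sub>v p + 0\<^sub>v m" using assms by auto
    then show ?case using gen_monoid_zero by blast
  next
    case (add p' z)
    then obtain k w where z: "z = int k \<cdot>\<^sub>v p + w" "w \<in> gen_monoid m P" by blast
    have w: "w \<in> carrier_vec m" using z(2) assms gen_monoid_carrier by blast
    show ?case
    proof (cases "p' = p")
      case True
      have "p' + z = int (Suc k) \<cdot>\<^sub>v p + w" unfolding True z(1) using assms w
        by (intro eq_vecI) (auto simp: algebra_simps)
      then show ?thesis using z(2) by blast
    next
      case False
      then have "p' \<in> P" using add by auto
      then have "p' + w \<in> gen_monoid m P" "p' \<in> carrier_vec m" using z(2) gen_monoid_add assms by auto
      moreover have "p' + z = int k \<cdot>\<^sub>v p + (p' + w)" unfolding z(1)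
        using assms w \<open>p' \<in> carrier_vec m\<close> by (intro eq_vecI) auto
      ultimately show ?thesis by blast
    qed
  qed
next
  fix z assume "z \<in> {int k \<cdot>\<^sub>v p + w | k w. w \<in> gen_monoid m P}"
  then obtain k w where z: "z = int k \<cdot>\<^sub>v p + w" "w \<in> gen_monoid m P" by blast
  have w: "w \<in> carrier_vec m" using z(2) assms gen_monoid_carrier by blast
  have "w \<in> gen_monoid m (insert p P)" using z(2) unfolding gen_monoid_def by auto
  then have "int k \<cdot>\<^sub>v p + w \<in> gen_monoid m (insert p P)"
  proof (induction k)
    case 0
    have "int 0 \<cdot>\<^sub>v p + w = w" using w assms by (intro eq_vecI) auto
    then show ?case using 0 by simp
  next
    case (Suc k)
    have "int (Suc k) \<cdot>\<^sub>v p + w = p + (int k \<cdot>\<^sub>v p + w)" using assms w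
      by (intro eq_vecI) (auto simp: algebra_simps)
    then show ?case using Suc gen_monoid_add[of p "insert p P"] by simp
  qed
  then show "z \<in> gen_monoid m (insert p P)" using z by simp
qed

text \<open>Induction on the generators, with one quantified nonnegative integer for the
  multiplicity of each. Generalising over \<open>g\<close> lets the induction hypothesis treat what
  is left after subtracting that multiple of \<open>p\<close>.\<close>

lemma definable_pred_gen_monoid:
  assumes "finite P" "P \<subseteq> carrier_vec m" "\<And>j. j < m \<Longrightarrow> definable_val (g j)"
  shows "definable_pred (\<lambda>e. \<exists>z\<in>gen_monoid m P. \<forall>j<m. g j e = of_int (z $ j))"
  using assms
proof (induction P arbitrary: g rule: finite_induct)
  case empty
  have "definable_pred (\<lambda>e. \<forall>j<m. g j e = 0)"
    by (intro definable_pred_all_less definable_pred_eq definable_val_zero empty)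
  then show ?case by (simp add: gen_monoid_empty)
next
  case (insert p P)
  have "\<forall>j<m. \<exists>N. \<forall>i\<ge>N. \<forall>e r. g j (e(i := r)) = g j e"
    using definable_val_support insert.prems(2) by metis
  then obtain N where N: "\<And>j i e r. j < m \<Longrightarrow> i \<ge> N j \<Longrightarrow> g j (e(i := r)) = g j e" by metis
  \<comment> \<open>A variable beyond the supports of all \<open>g j\<close>; the inserted 0 covers
    \<open>m = 0\<close>.\<close>
  define a where "a = Max (insert 0 (N ` {..<m}))"
  have a: "g j (e(a := r)) = g j e" if "j < m" for j e r
    by (rule N[OF that]) (use that in \<open>auto simp: a_def\<close>)
  have "definable_pred (\<lambda>e. \<exists>r. 0 \<le> (e(a := r)) a \<and> (e(a := r)) a \<in> \<int> \<and>
      (\<exists>z\<in>gen_monoid m P. \<forall>j<m. g j (e(a := r)) - of_int (p $ j) * (e(a := r)) a = of_int (z $ j)))"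
    using insert.prems
    by (intro definable_pred_ex definable_pred_conj definable_pred_le definable_pred_int
      definable_val_zero definable_val_var insert.IH definable_val_diff definable_val_of_int_mult) auto
  also have "(\<lambda>e. \<exists>r. 0 \<le> (e(a := r)) a \<and> (e(a := r)) a \<in> \<int> \<and>
      (\<exists>z\<in>gen_monoid m P. \<forall>j<m. g j (e(a := r)) - of_int (p $ j) * (e(a := r)) a = of_int (z $ j))) =
      (\<lambda>e. \<exists>z\<in>gen_monoid m (insert p P). \<forall>j<m. g j e = of_int (z $ j))"
  proof (intro ext iffI)
    fix e assume "\<exists>r. 0 \<le> (e(a := r)) a \<and> (e(a := r)) a \<in> \<int> \<and>
      (\<exists>z\<in>gen_monoid m P. \<forall>j<m. g j (e(a := r)) - of_int (p $ j) * (e(a := r)) a = of_int (z $ j))"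
    then obtain r z where r: "0 \<le> r" "r \<in> \<int>" "z \<in> gen_monoid m P"
      "\<forall>j<m. g j e - of_int (p $ j) * r = of_int (z $ j)"
      by (auto simp: a)
    then obtain k where k: "r = of_int k" using Ints_cases by metis
    have z: "z \<in> carrier_vec m" using r(3) insert.prems gen_monoid_carrier by blast
    have "int (nat k) \<cdot>\<^sub>v p + z \<in> gen_monoid m (insert p P)"
      using gen_monoid_insert[of p m P] insert.prems r(3) by blast
    moreover have "g j e = of_int ((int (nat k) \<cdot>\<^sub>v p + z) $ j)" if "j < m" for j
    proof -
      have "p \<in> carrier_vec m" using insert.prems(1) by simp
      then show ?thesis using r(4)[rule_format, OF that] r(1) k z that by (simp add: algebra_simps)
    qed
    ultimately show "\<exists>z\<in>gen_monoid m (insert p P). \<forall>j<m. g j e = of_int (z $ j)" by blast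
  next
    fix e assume "\<exists>z\<in>gen_monoid m (insert p P). \<forall>j<m. g j e = of_int (z $ j)"
    then obtain k w where w: "w \<in> gen_monoid m P" "\<forall>j<m. g j e = of_int ((int k \<cdot>\<^sub>v p + w) $ j)"
      using gen_monoid_insert[of p m P] insert.prems by auto
    have wc: "w \<in> carrier_vec m" using w(1) insert.prems gen_monoid_carrier by blast
    show "\<exists>r. 0 \<le> (e(a := r)) a \<and> (e(a := r)) a \<in> \<int> \<and>
      (\<exists>z\<in>gen_monoid m P. \<forall>j<m. g j (e(a := r)) - of_int (p $ j) * (e(a := r)) a = of_int (z $ j))"
      using w wc insert.prems(1) by (intro exI[of _ "of_nat k"]) (auto simp: a algebra_simps intro!: bexI[of _ w])
  qed
  finally show ?case .
qed

lemma unit_cube_add_int: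
  assumes "c \<in> unit_cube m" "z \<in> carrier_vec m" "i < m"
  shows "frac ((c + map_vec real_of_int z) $ i) = c $ i" "\<lfloor>(c + map_vec real_of_int z) $ i\<rfloor> = z $ i"
proof -
  have "0 \<le> c $ i" "c $ i < 1" using assms unfolding unit_cube_def by auto
  then show "\<lfloor>(c + map_vec real_of_int z) $ i\<rfloor> = z $ i" using assms by (intro floor_unique) auto
  then show "frac ((c + map_vec real_of_int z) $ i) = c $ i" using assms unfolding frac_def by simp
qed

text \<open>The decomposition into a cube point and an integer vector is unique, so membership says
  that the fractional parts lie in \<open>C\<close> and the floors minus \<open>b\<close> lie in
  \<open>M\<close>.\<close>

lemma polinear_definable:
  assumes "polinear m S"
  shows "definable_set m S"
proof -
  obtain C b M where *: "polyhedral_convex m C" "C \<subseteq> unit_cube m" "b \<in> carrier_vec m" "fg_monoid m M"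
    "S = {c + map_vec real_of_int (b + z) | c z. c \<in> C \<and> z \<in> M}"
    using assms unfolding polinear_def by blast
  obtain P where P: "P \<subseteq> carrier_vec m" "finite P" "M = gen_monoid m P" using *(4) unfolding fg_monoid_def by blast
  obtain cs :: "(rat vec \<times> (real \<Rightarrow> real \<Rightarrow> bool) \<times> rat) list"
    where cs: "\<forall>(\<alpha>, R, \<beta>) \<in> set cs. \<alpha> \<in> carrier_vec m \<and> R \<in> {(<), (\<le>), (=), (\<ge>), (>)}"
    "C = {c \<in> carrier_vec m. \<forall>(\<alpha>, R, \<beta>) \<in> set cs. R (\<Sum>i<m. of_rat (\<alpha> $ i) * c $ i) (of_rat \<beta>)}"
    using *(1) unfolding polyhedral_convex_def by blast
  have Cc: "C \<subseteq> carrier_vec m" and Mc: "M \<subseteq> carrier_vec m"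
    using cs(2) P gen_monoid_carrier by blast+
  have 1: "definable_pred (\<lambda>e. \<forall>x \<in> set cs. (case x of (\<alpha>, R, \<beta>) \<Rightarrow>
      R (\<Sum>i<m. of_rat (\<alpha> $ i) * frac (e i)) (of_rat \<beta>)))"
  proof (rule definable_pred_ball)
    fix x assume "x \<in> set cs"
    then obtain \<alpha> R \<beta> where x: "x = (\<alpha>, R, \<beta>)" "R \<in> {(<), (\<le>), (=), (\<ge>), (>)}" using cs(1) by auto
    show "definable_pred (\<lambda>e. case x of (\<alpha>, R, \<beta>) \<Rightarrow> R (\<Sum>i<m. of_rat (\<alpha> $ i) * frac (e i)) (of_rat \<beta>))"
      unfolding x(1) prod.case
      by (intro definable_pred_order x definable_val_sum definable_val_of_rat_mult definable_val_frac
        definable_val_var definable_val_of_rat finite_lessThan)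
  qed simp
  have C: "vec m (\<lambda>i. frac (e i)) \<in> C \<longleftrightarrow> (\<forall>x \<in> set cs. (case x of (\<alpha>, R, \<beta>) \<Rightarrow>
      R (\<Sum>i<m. of_rat (\<alpha> $ i) * frac (e i)) (of_rat \<beta>)))" for e
    unfolding cs(2) by auto
  \<comment> \<open>The factor 1 presents the coordinates of \<open>b\<close> as integer multiples
    of the definable value 1.\<close>
  have 2: "definable_pred (\<lambda>e. \<exists>z\<in>M. \<forall>j<m. of_int \<lfloor>e j\<rfloor> - of_int (b $ j) * 1 = real_of_int (z $ j))"
    unfolding P(3) by (intro definable_pred_gen_monoid P definable_val_diff definable_val_floor
      definable_val_var definable_val_of_int_mult definable_val_one)
  have "vec m e \<in> S \<longleftrightarrow> vec m (\<lambda>i. frac (e i)) \<in> C \<and>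
     (\<exists>z\<in>M. \<forall>j<m. of_int \<lfloor>e j\<rfloor> - of_int (b $ j) * 1 = real_of_int (z $ j))" for e
  proof
    assume "vec m e \<in> S"
    then obtain c z where cz: "vec m e = c + map_vec real_of_int (b + z)" "c \<in> C" "z \<in> M" using *(5) by auto
    have dims: "c \<in> unit_cube m" "c \<in> carrier_vec m" "z \<in> carrier_vec m" using cz *(2) Cc Mc by auto
    have "frac (e i) = c $ i \<and> \<lfloor>e i\<rfloor> = b $ i + z $ i" if "i < m" for i
      using unit_cube_add_int[OF dims(1) _ that, of "b + z"] dims *(3) that
      by (simp flip: cz(1))
    then have "vec m (\<lambda>i. frac (e i)) = c" "\<forall>j<m. of_int \<lfloor>e j\<rfloor> - of_int (b $ j) * 1 = real_of_int (z $ j)"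
      using dims by (auto intro!: eq_vecI)
    then show "vec m (\<lambda>i. frac (e i)) \<in> C \<and>
     (\<exists>z\<in>M. \<forall>j<m. of_int \<lfloor>e j\<rfloor> - of_int (b $ j) * 1 = real_of_int (z $ j))" using cz by blast
  next
    assume "vec m (\<lambda>i. frac (e i)) \<in> C \<and>
     (\<exists>z\<in>M. \<forall>j<m. of_int \<lfloor>e j\<rfloor> - of_int (b $ j) * 1 = real_of_int (z $ j))"
    then obtain z where z: "vec m (\<lambda>i. frac (e i)) \<in> C" "z \<in> M"
      "\<And>j. j < m \<Longrightarrow> of_int \<lfloor>e j\<rfloor> - of_int (b $ j) * 1 = real_of_int (z $ j)" by auto
    have zc: "z \<in> carrier_vec m" using z(2) Mc by auto
    have "vec m e = vec m (\<lambda>i. frac (e i)) + map_vec real_of_int (b + z)"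
      using zc *(3) z(3) by (intro eq_vecI) (auto simp: frac_def algebra_simps)
    then show "vec m e \<in> S" using z *(5) by blast
  qed
  then have "definable_pred (\<lambda>e. vec m e \<in> S)" using definable_pred_conj[OF 1 2] by (simp add: C)
  moreover have "S \<subseteq> carrier_vec m" using *(3) Cc Mc unfolding *(5) by (auto simp: subset_iff)
  ultimately show ?thesis by (simp add: definable_set_iff)
qed

lemma definable_set_Union:
  assumes "finite F" "\<And>S. S \<in> F \<Longrightarrow> definable_set m S"
  shows "definable_set m (\<Union>F)"
  using assms definable_pred_bex[of F "\<lambda>S e. vec m e \<in> S"] unfolding definable_set_iff by auto

lemma definable_set_Diff: "definable_set m S \<Longrightarrow> definable_set m T \<Longrightarrow> definable_set m (S - T)"
  using definable_pred_conj[OF _ definable_pred_not, of "\<lambda>e. vec m e \<in> S" "\<lambda>e. vec m e \<in> T"]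
  unfolding definable_set_iff by auto

lemma semi_polinear_definable: "semi_polinear m S \<Longrightarrow> definable_set m S"
  unfolding semi_polinear_def using definable_set_Union polinear_definable by blast

lemma definable_set_projection:
  assumes "definable_set (n + q) S"
  shows "definable_set n {x \<in> carrier_vec n. \<exists>y \<in> carrier_vec q. x @\<^sub>v y \<in> S}"
proof -
  have "definable_pred (\<lambda>e. \<exists>e'. (\<forall>i. i \<notin> {n..<n + q} \<longrightarrow> e' i = e i) \<and> vec (n + q) e' \<in> S)"
    using assms by (intro definable_pred_ex_finite) (auto simp: definable_set_iff)
  also have "(\<lambda>e. \<exists>e'. (\<forall>i. i \<notin> {n..<n + q} \<longrightarrow> e' i = e i) \<and> vec (n + q) e' \<in> S) =
     (\<lambda>e. vec n e \<in> {x \<in> carrier_vec n. \<exists>y \<in> carrier_vec q. x @\<^sub>v y \<in> S})"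
  proof (intro ext iffI)
    fix e :: "nat \<Rightarrow> real"
    assume "\<exists>e'. (\<forall>i. i \<notin> {n..<n + q} \<longrightarrow> e' i = e i) \<and> vec (n + q) e' \<in> S"
    then obtain e' where e': "\<forall>i. i \<notin> {n..<n + q} \<longrightarrow> e' i = e i" "vec (n + q) e' \<in> S" by blast
    have "vec (n + q) e' = vec n e @\<^sub>v vec q (\<lambda>i. e' (n + i))" using e'(1) by (intro eq_vecI) auto
    then show "vec n e \<in> {x \<in> carrier_vec n. \<exists>y \<in> carrier_vec q. x @\<^sub>v y \<in> S}"
      using e'(2) by (auto intro!: bexI[of _ "vec q (\<lambda>i. e' (n + i))"])
  next
    fix e :: "nat \<Rightarrow> real"
    assume "vec n e \<in> {x \<in> carrier_vec n. \<exists>y \<in> carrier_vec q. x @\<^sub>v y \<in> S}"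
    then obtain y where y: "y \<in> carrier_vec q" "vec n e @\<^sub>v y \<in> S" by blast
    let ?e = "\<lambda>i. if i \<in> {n..<n + q} then y $ (i - n) else e i"
    have "vec (n + q) ?e = vec n e @\<^sub>v y" using y(1) by (intro eq_vecI) auto
    then show "\<exists>e'. (\<forall>i. i \<notin> {n..<n + q} \<longrightarrow> e' i = e i) \<and> vec (n + q) e' \<in> S"
      using y(2) by (intro exI[of _ ?e]) auto
  qed
  finally show ?thesis by (simp add: definable_set_iff subset_iff)
qed


subsection \<open>Functional polinear sets\<close>

text \<open>Elimination of the last coordinate: the members with \<open>v n = 0\<close> satisfy the
  hypotheses for \<open>n\<close>, and one member \<open>u\<close> with \<open>u n = 1\<close> fixes
  the remaining coefficient, because subtracting \<open>v n\<close> times \<open>u\<close> from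
  \<open>v\<close> gives a member of that kind. Used for the monoid and for the polyhedral part
  alike.\<close>

lemma functional_subspace_linear:
  fixes V :: "((nat \<Rightarrow> 'a::field) \<times> 'a) set"
  assumes add: "\<And>u s v t. (u, s) \<in> V \<Longrightarrow> (v, t) \<in> V \<Longrightarrow> (\<lambda>i. u i + v i, s + t) \<in> V"
    and scale: "\<And>r v t. (v, t) \<in> V \<Longrightarrow> (\<lambda>i. r * v i, r * t) \<in> V"
    and functional: "\<And>v t. (v, t) \<in> V \<Longrightarrow> \<forall>i<n. v i = 0 \<Longrightarrow> t = 0"
  shows "\<exists>a. \<forall>v t. (v, t) \<in> V \<longrightarrow> t = (\<Sum>i<n. a i * v i)"
  using assms
proof (induction n arbitrary: V)
  case 0
  then show ?case by auto
next
  case (Suc n)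
  have "\<exists>a. \<forall>v t. (v, t) \<in> {(v, t). (v, t) \<in> V \<and> v n = 0} \<longrightarrow> t = (\<Sum>i<n. a i * v i)"
    by (rule Suc.IH) (use Suc.prems in \<open>auto simp: less_Suc_eq\<close>)
  then obtain a where a: "\<And>v t. (v, t) \<in> V \<Longrightarrow> v n = 0 \<Longrightarrow> t = (\<Sum>i<n. a i * v i)" by auto
  show ?case
  proof (cases "\<exists>u s. (u, s) \<in> V \<and> u n \<noteq> 0")
    case True
    then obtain u0 s0 where u0: "(u0, s0) \<in> V" "u0 n \<noteq> 0" by blast
    define u where "u i = inverse (u0 n) * u0 i" for i
    define s where "s = inverse (u0 n) * s0"
    have u: "(u, s) \<in> V" unfolding u_def s_def by (rule Suc.prems(2)[OF u0(1)])
    have un: "u n = 1" using u0 unfolding u_def by simp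
    \<comment> \<open>The last coefficient makes the formula exact at \<open>u\<close>.\<close>
    define b where "b i = (if i = n then s - (\<Sum>i<n. a i * u i) else a i)" for i
    have "t = (\<Sum>i<Suc n. b i * v i)" if v: "(v, t) \<in> V" for v t
    proof -
      have "(\<lambda>i. v i + - v n * u i, t + - v n * s) \<in> V"
        by (rule Suc.prems(1)[OF v Suc.prems(2)[OF u]])
      from a[OF this] have "t + - v n * s = (\<Sum>i<n. a i * (v i + - v n * u i))" using un by simp
      also have "\<dots> = (\<Sum>i<n. a i * v i) - v n * (\<Sum>i<n. a i * u i)"
        by (simp add: sum_distrib_left sum_subtractf algebra_simps)
      finally have "t = (\<Sum>i<n. a i * v i) + (s - (\<Sum>i<n. a i * u i)) * v n"
        by (simp add: algebra_simps)
      moreover have "(\<Sum>i<n. b i * v i) = (\<Sum>i<n. a i * v i)"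
        unfolding b_def by (intro sum.cong) auto
      ultimately show ?thesis by (simp add: b_def)
    qed
    then show ?thesis by blast
  next
    case False
    have "t = (\<Sum>i<Suc n. a i * v i)" if "(v, t) \<in> V" for v t
      using a[OF that] False that by auto
    then show ?thesis by blast
  qed
qed

text \<open>\<open>M\<close> lacks differences and quotients, so the formula is found on its
  rational span. An element of the span that vanishes in the first \<open>n\<close> coordinates is,
  up to a denominator, the difference of two members of \<open>M\<close> that agree there.\<close>

lemma monoid_functional_linear:
  fixes M :: "int vec set"
  assumes dim: "M \<subseteq> carrier_vec m" "n \<le> m" "i < m"
    and zero: "0\<^sub>v m \<in> M" and add: "\<And>x y. x \<in> M \<Longrightarrow> y \<in> M \<Longrightarrow> x + y \<in> M"
    and functional: "\<And>x y. x \<in> M \<Longrightarrow> y \<in> M \<Longrightarrow> \<forall>j<n. x $ j = y $ j \<Longrightarrow> x $ i = y $ i"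
  shows "\<exists>b :: nat \<Rightarrow> rat. \<forall>z\<in>M. of_int (z $ i) = (\<Sum>j<n. b j * of_int (z $ j))"
proof -
  have mult: "int k \<cdot>\<^sub>v x \<in> M" if "x \<in> M" for k x
  proof (induction k)
    case 0
    have "int 0 \<cdot>\<^sub>v x = 0\<^sub>v m" using that dim by (intro eq_vecI) auto
    then show ?case using zero by simp
  next
    case (Suc k)
    have "int (Suc k) \<cdot>\<^sub>v x = int k \<cdot>\<^sub>v x + x" using that dim by (intro eq_vecI) (auto simp: algebra_simps)
    then show ?case using add Suc that by simp
  qed
  \<comment> \<open>the rational span of \<open>M\<close>: over a common denominator, a combination is a difference in \<open>M\<close>\<close>
  define V :: "((nat \<Rightarrow> rat) \<times> rat) set" where "V = {(v, t). \<exists>N u w. N > 0 \<and> u \<in> M \<and> w \<in> M \<and>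
     (\<forall>j<n. of_nat N * v j = of_int (u $ j) - of_int (w $ j)) \<and> of_nat N * t = of_int (u $ i) - of_int (w $ i)}"
  have "\<exists>a. \<forall>v t. (v, t) \<in> V \<longrightarrow> t = (\<Sum>j<n. a j * v j)"
  proof (rule functional_subspace_linear)
    fix v1 t1 v2 t2
    assume "(v1, t1) \<in> V" "(v2, t2) \<in> V"
    then obtain N1 u1 w1 N2 u2 w2 where *: "N1 > 0" "u1 \<in> M" "w1 \<in> M" "N2 > 0" "u2 \<in> M" "w2 \<in> M"
      "\<And>j. j < n \<Longrightarrow> of_nat N1 * v1 j = of_int (u1 $ j) - of_int (w1 $ j)" "of_nat N1 * t1 = of_int (u1 $ i) - of_int (w1 $ i)"
      "\<And>j. j < n \<Longrightarrow> of_nat N2 * v2 j = of_int (u2 $ j) - of_int (w2 $ j)" "of_nat N2 * t2 = of_int (u2 $ i) - of_int (w2 $ i)"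
      unfolding V_def by auto
    have dims: "u1 \<in> carrier_vec m" "w1 \<in> carrier_vec m" "u2 \<in> carrier_vec m" "w2 \<in> carrier_vec m"
      using * dim by auto
    \<comment> \<open>Crosswise scaling brings both differences over the denominator
      \<open>N1 * N2\<close>.\<close>
    let ?u = "int N2 \<cdot>\<^sub>v u1 + int N1 \<cdot>\<^sub>v u2" and ?w = "int N2 \<cdot>\<^sub>v w1 + int N1 \<cdot>\<^sub>v w2"
    have coord: "of_nat (N1 * N2) * (x1 + x2) = of_int (?u $ j) - of_int (?w $ j)"
      if "j < m" "of_nat N1 * x1 = of_int (u1 $ j) - of_int (w1 $ j)"
        "of_nat N2 * x2 = of_int (u2 $ j) - of_int (w2 $ j)" for j and x1 x2 :: rat
    proof -
      have "of_nat (N1 * N2) * (x1 + x2) = of_nat N2 * (of_nat N1 * x1) + of_nat N1 * (of_nat N2 * x2)"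
        by (simp add: algebra_simps)
      also have "\<dots> = of_int (?u $ j) - of_int (?w $ j)"
        unfolding that(2,3) using that(1) dims by (simp add: algebra_simps)
      finally show ?thesis .
    qed
    show "(\<lambda>j. v1 j + v2 j, t1 + t2) \<in> V"
      unfolding V_def mem_Collect_eq prod.case
      by (rule exI[of _ "N1 * N2"], rule exI[of _ ?u], rule exI[of _ ?w])
        (use * dim in \<open>auto intro!: add mult coord simp del: of_nat_mult\<close>)
  next
    fix r :: rat and v t
    assume "(v, t) \<in> V"
    then obtain N u w where *: "N > 0" "u \<in> M" "w \<in> M"
      "\<And>j. j < n \<Longrightarrow> of_nat N * v j = of_int (u $ j) - of_int (w $ j)" "of_nat N * t = of_int (u $ i) - of_int (w $ i)"
      unfolding V_def by auto
    have dims: "u \<in> carrier_vec m" "w \<in> carrier_vec m" using * dim by auto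
    obtain a b where r: "r = of_int a / of_int b" "b > 0" by (cases r) (auto simp: Fract_of_int_quotient)
    \<comment> \<open>\<open>M\<close> is closed only under natural multiples, so a negative
      numerator exchanges \<open>u\<close> and \<open>w\<close>.\<close>
    define u' w' where "u' = (if a \<ge> 0 then u else w)" and "w' = (if a \<ge> 0 then w else u)"
    define k where "k = nat \<bar>a\<bar>"
    let ?u = "int k \<cdot>\<^sub>v u'" and ?w = "int k \<cdot>\<^sub>v w'"
    have coord: "of_nat (N * nat b) * (r * x) = of_int (?u $ j) - of_int (?w $ j)"
      if "j < m" "of_nat N * x = of_int (u $ j) - of_int (w $ j)" for j and x :: rat
    proof -
      have "of_nat (N * nat b) * (r * x) = of_int a * (of_nat N * x)"
        using r by simp
      also have "\<dots> = of_int (?u $ j) - of_int (?w $ j)"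
        unfolding that(2) u'_def w'_def k_def using that(1) dims by (simp add: algebra_simps)
      finally show ?thesis .
    qed
    have "u' \<in> M" "w' \<in> M" using * unfolding u'_def w'_def by auto
    then have "?u \<in> M" "?w \<in> M" by (simp_all only: mult)
    moreover have "\<forall>j<n. of_nat (N * nat b) * (r * v j) = of_int (?u $ j) - of_int (?w $ j)"
      by (intro allI impI coord *) (use dim in auto)
    moreover have "of_nat (N * nat b) * (r * t) = of_int (?u $ i) - of_int (?w $ i)"
      by (intro coord *) (use dim in auto)
    moreover have "N * nat b > 0" using * r(2) by simp
    ultimately show "(\<lambda>j. r * v j, r * t) \<in> V" unfolding V_def by blast
  next
    fix v t
    assume "(v, t) \<in> V" "\<forall>j<n. v j = 0"
    then obtain N u w where *: "N > 0" "u \<in> M" "w \<in> M"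
      "\<forall>j<n. u $ j = w $ j" "of_nat N * t = of_int (u $ i) - of_int (w $ i)"
      unfolding V_def by auto
    then show "t = 0" using functional[of u w] by simp
  qed
  then obtain a where a: "\<And>v t. (v, t) \<in> V \<Longrightarrow> t = (\<Sum>j<n. a j * v j)" by blast
  have "(\<lambda>j. of_int (z $ j), of_int (z $ i)) \<in> V" if "z \<in> M" for z
    unfolding V_def mem_Collect_eq prod.case
    by (rule exI[of _ 1], rule exI[of _ z], rule exI[of _ "0\<^sub>v m"]) (use that zero dim in auto)
  then show ?thesis using a by blast
qed

text \<open>
  At a point with fewest tight constraints, every constraint that is tight there is an equation
  valid on all of \<open>C\<close>, and the remaining constraints allow small moves in every direction.
  Functionality therefore forces the target coordinate to vanish on the kernel of these equations,
  which makes it a rational combination of them.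
\<close>

lemma polyhedral_functional_affine:
  fixes m n i :: nat
  assumes poly: "polyhedral_convex m C" and ne: "C \<noteq> {}" and dim: "n \<le> m" "i < m"
    and functional: "\<And>c c'. c \<in> C \<Longrightarrow> c' \<in> C \<Longrightarrow> \<forall>j<n. c $ j = c' $ j \<Longrightarrow> c $ i = c' $ i"
  shows "\<exists>(\<alpha> :: rat) (a :: nat \<Rightarrow> rat). \<forall>c\<in>C. c $ i = of_rat \<alpha> + (\<Sum>j<n. of_rat (a j) * c $ j)"
proof -
  obtain cs :: "(rat vec \<times> (real \<Rightarrow> real \<Rightarrow> bool) \<times> rat) list"
    where cs: "\<forall>(\<alpha>, R, \<beta>) \<in> set cs. \<alpha> \<in> carrier_vec m \<and> R \<in> {(<), (\<le>), (=), (\<ge>), (>)}"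
    "C = {c \<in> carrier_vec m. \<forall>(\<alpha>, R, \<beta>) \<in> set cs. R (\<Sum>i<m. of_rat (\<alpha> $ i) * c $ i) (of_rat \<beta>)}"
    using poly unfolding polyhedral_convex_def by blast
  define L where "L \<alpha> c = (\<Sum>i<m. of_rat (\<alpha> $ i) * c $ i)" for \<alpha> :: "rat vec" and c :: "real vec"
  have inC: "c \<in> C \<longleftrightarrow> c \<in> carrier_vec m \<and> (\<forall>\<alpha> R \<beta>. (\<alpha>, R, \<beta>) \<in> set cs \<longrightarrow> R (L \<alpha> c) (of_rat \<beta>))" for c
    unfolding cs(2) L_def by auto
  have R: "R = (<) \<or> R = (\<le>) \<or> R = (=) \<or> R = (\<ge>) \<or> R = (>)" if "(\<alpha>, R, \<beta>) \<in> set cs" for \<alpha> R \<beta>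
    using cs(1) that by auto
  define tight where "tight c = {(\<alpha>, R, \<beta>). (\<alpha>, R, \<beta>) \<in> set cs \<and> L \<alpha> c = of_rat \<beta>}" for c
  have fin: "finite (tight c)" for c
    by (rule finite_subset[of _ "set cs"]) (auto simp: tight_def)
  obtain c0 where c0: "c0 \<in> C" "\<And>c. c \<in> C \<Longrightarrow> card (tight c0) \<le> card (tight c)"
    using ex_has_least_nat[of "\<lambda>c. c \<in> C" _ "\<lambda>c. card (tight c)"] ne by blast
  have c0m: "c0 \<in> carrier_vec m" using c0 inC by auto
  have tight_C: "L \<alpha> c = of_rat \<beta>" if c: "c \<in> C" and x: "(\<alpha>, R, \<beta>) \<in> tight c0" for c \<alpha> R \<beta>
  proof -
    \<comment> \<open>At the midpoint of \<open>c\<close> and \<open>c0\<close> a constraint is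
      tight only if it is tight at both ends. By minimality of \<open>c0\<close> the tight sets of
      \<open>d\<close> and \<open>c0\<close> coincide, so the given constraint is tight at
      \<open>c\<close> too.\<close>
    define d where "d = vec m (\<lambda>i. (c $ i + c0 $ i) / 2)"
    have Ld: "L \<alpha> d = (L \<alpha> c + L \<alpha> c0) / 2" for \<alpha>
    proof -
      have "L \<alpha> d = (\<Sum>i<m. (of_rat (\<alpha> $ i) * c $ i + of_rat (\<alpha> $ i) * c0 $ i) / 2)"
        unfolding L_def d_def by (intro sum.cong) (auto simp: algebra_simps)
      then show ?thesis unfolding L_def by (simp add: sum.distrib flip: sum_divide_distrib)
    qed
    have Rc: "R (L \<alpha> c) (of_rat \<beta>)" "R (L \<alpha> c0) (of_rat \<beta>)" if "(\<alpha>, R, \<beta>) \<in> set cs" for \<alpha> R \<beta>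
      using c c0 inC that by blast+
    have "d \<in> C" unfolding inC
    proof (intro conjI allI impI)
      show "d \<in> carrier_vec m" unfolding d_def by simp
      fix \<alpha> R \<beta> assume "(\<alpha>, R, \<beta>) \<in> set cs"
      with R[OF this] Rc[OF this] show "R (L \<alpha> d) (of_rat \<beta>)" unfolding Ld by (auto simp: field_simps)
    qed
    have both: "L \<alpha> c = of_rat \<beta> \<and> L \<alpha> c0 = of_rat \<beta>" if "(\<alpha>, R, \<beta>) \<in> tight d" for \<alpha> R \<beta>
    proof -
      have "(\<alpha>, R, \<beta>) \<in> set cs" "L \<alpha> c + L \<alpha> c0 = 2 * of_rat \<beta>" using that unfolding tight_def Ld by auto
      with R[OF this(1)] Rc[OF this(1)] show ?thesis by auto
    qed
    have "tight d \<subseteq> tight c0" using both unfolding tight_def by auto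
    then have "tight d = tight c0" using c0(2)[OF \<open>d \<in> C\<close>] fin by (intro card_seteq)
    then show ?thesis using both x by blast
  qed
  have kernel: "v i = 0" if v: "\<forall>j<n. v j = 0" "\<And>\<alpha> R \<beta>. (\<alpha>, R, \<beta>) \<in> tight c0 \<Longrightarrow> (\<Sum>j<m. \<alpha> $ j * v j) = 0"
    for v :: "nat \<Rightarrow> rat"
  proof -
    \<comment> \<open>A move from \<open>c0\<close> along \<open>v\<close>: tight forms keep their
      values, the other constraints hold strictly and survive small \<epsilon> by continuity. The
      first \<open>n\<close> coordinates stay fixed, so functionality fixes coordinate
      \<open>i\<close>.\<close>
    define d where "d \<epsilon> = vec m (\<lambda>j. c0 $ j + \<epsilon> * of_rat (v j))" for \<epsilon> :: real
    have Ld: "L \<alpha> (d \<epsilon>) = L \<alpha> c0 + \<epsilon> * of_rat (\<Sum>j<m. \<alpha> $ j * v j)" for \<alpha> \<epsilon>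
    proof -
      have "L \<alpha> (d \<epsilon>) = (\<Sum>j<m. of_rat (\<alpha> $ j) * c0 $ j + \<epsilon> * of_rat (\<alpha> $ j * v j))"
        unfolding L_def d_def by (intro sum.cong) (auto simp: algebra_simps of_rat_mult)
      then show ?thesis unfolding L_def by (simp add: sum.distrib of_rat_sum sum_distrib_left)
    qed
    have "\<forall>\<^sub>F \<epsilon> in at_right 0. R (L \<alpha> (d \<epsilon>)) (of_rat \<beta>)" if x: "(\<alpha>, R, \<beta>) \<in> set cs" for \<alpha> R \<beta>
    proof (cases "(\<alpha>, R, \<beta>) \<in> tight c0")
      case True
      then have "L \<alpha> (d \<epsilon>) = L \<alpha> c0" for \<epsilon> using v(2) unfolding Ld by simp
      moreover have "R (L \<alpha> c0) (of_rat \<beta>)" using c0(1) x unfolding inC by blast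
      ultimately show ?thesis by simp
    next
      case False
      have lim: "((\<lambda>\<epsilon>. L \<alpha> (d \<epsilon>)) \<longlongrightarrow> L \<alpha> c0) (at_right 0)"
        unfolding Ld by (auto intro!: tendsto_eq_intros)
      have "R (L \<alpha> c0) (of_rat \<beta>)" "L \<alpha> c0 \<noteq> of_rat \<beta>" using c0(1) x inC False unfolding tight_def by auto
      with R[OF x] consider "R = (<) \<or> R = (\<le>)" "L \<alpha> c0 < of_rat \<beta>" | "R = (>) \<or> R = (\<ge>)" "L \<alpha> c0 > of_rat \<beta>"
        by fastforce
      then show ?thesis
      proof cases
        case 1
        show ?thesis using order_tendstoD(2)[OF lim 1(2)] by eventually_elim (use 1(1) in auto)
      next
        case 2
        show ?thesis using order_tendstoD(1)[OF lim 2(2)] by eventually_elim (use 2(1) in auto)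
      qed
    qed
    then have "\<forall>\<^sub>F \<epsilon> in at_right 0. \<forall>x\<in>set cs. (case x of (\<alpha>, R, \<beta>) \<Rightarrow> R (L \<alpha> (d \<epsilon>)) (of_rat \<beta>))"
      by (intro eventually_ball_finite) auto
    then have "\<forall>\<^sub>F \<epsilon> in at_right 0. 0 < \<epsilon> \<and> d \<epsilon> \<in> C"
      using eventually_at_right_less[of 0] by eventually_elim (auto simp: inC d_def)
    then obtain \<epsilon> where \<epsilon>: "0 < \<epsilon>" "d \<epsilon> \<in> C"
      using eventually_happens'[OF trivial_limit_at_right_real] by blast
    have "d \<epsilon> $ i = c0 $ i"
      by (rule functional) (use \<epsilon> c0(1) v(1) dim(1) in \<open>auto simp: d_def\<close>)
    then show ?thesis using \<epsilon>(1) dim(2) unfolding d_def by simp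
  qed
  obtain ts where ts: "set ts = tight c0" using finite_list[OF fin] by blast
  define A where "A k = fst (ts ! k)" for k
  define \<beta> where "\<beta> k = snd (snd (ts ! k))" for k
  have A: "L (A k) c = of_rat (\<beta> k)" if "k < length ts" "c \<in> C" for k c
    using tight_C[OF that(2), of "A k" "fst (snd (ts ! k))" "\<beta> k"] nth_mem[OF that(1)] ts
    unfolding A_def \<beta>_def by simp
  \<comment> \<open>Values of the tight forms on vectors vanishing in the first \<open>n\<close>
    coordinates, paired with coordinate \<open>i\<close>. By \<open>kernel\<close> the former
    determine the latter, which is therefore a rational combination of them.\<close>
  define V :: "((nat \<Rightarrow> rat) \<times> rat) set" where "V = {(w, t). \<exists>v. (\<forall>j<n. v j = 0) \<and>
    (\<forall>k<length ts. w k = (\<Sum>j<m. A k $ j * v j)) \<and> t = v i}"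
  have "\<exists>a. \<forall>w t. (w, t) \<in> V \<longrightarrow> t = (\<Sum>k<length ts. a k * w k)"
  proof (rule functional_subspace_linear)
    fix w1 t1 w2 t2
    assume "(w1, t1) \<in> V" "(w2, t2) \<in> V"
    then obtain v1 v2 where "\<forall>j<n. v1 j = 0" "\<forall>k<length ts. w1 k = (\<Sum>j<m. A k $ j * v1 j)" "t1 = v1 i"
      "\<forall>j<n. v2 j = 0" "\<forall>k<length ts. w2 k = (\<Sum>j<m. A k $ j * v2 j)" "t2 = v2 i"
      unfolding V_def by blast
    then show "(\<lambda>k. w1 k + w2 k, t1 + t2) \<in> V" unfolding V_def
      by (auto simp: sum.distrib[symmetric] distrib_left intro!: exI[of _ "\<lambda>j. v1 j + v2 j"])
  next
    fix r :: rat and w t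
    assume "(w, t) \<in> V"
    then obtain v where "\<forall>j<n. v j = 0" "\<forall>k<length ts. w k = (\<Sum>j<m. A k $ j * v j)" "t = v i"
      unfolding V_def by blast
    then show "(\<lambda>k. r * w k, r * t) \<in> V" unfolding V_def
      by (auto simp: sum_distrib_left mult.left_commute intro!: exI[of _ "\<lambda>j. r * v j"])
  next
    fix w t
    assume "(w, t) \<in> V" and w: "\<forall>k<length ts. w k = 0"
    then obtain v where v: "\<forall>j<n. v j = 0" "\<forall>k<length ts. w k = (\<Sum>j<m. A k $ j * v j)" "t = v i"
      unfolding V_def by blast
    have "v i = 0"
    proof (rule kernel[OF v(1)])
      fix \<alpha> R \<beta> assume "(\<alpha>, R, \<beta>) \<in> tight c0"
      then obtain k where "k < length ts" "ts ! k = (\<alpha>, R, \<beta>)" using ts by (metis in_set_conv_nth)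
      then show "(\<Sum>j<m. \<alpha> $ j * v j) = 0" using v(2) w unfolding A_def by auto
    qed
    then show "t = 0" using v by simp
  qed
  then obtain \<mu> where \<mu>: "\<And>w t. (w, t) \<in> V \<Longrightarrow> t = (\<Sum>k<length ts. \<mu> k * w k)" by blast
  \<comment> \<open>Coefficients of coordinate \<open>i\<close> minus that combination of tight
    forms. Testing on unit vectors shows that they vanish from index \<open>n\<close> on.\<close>
  define \<gamma> where "\<gamma> j = (if j = i then 1 else 0) - (\<Sum>k<length ts. \<mu> k * A k $ j)" for j
  have \<gamma>: "\<gamma> j = 0" if j: "n \<le> j" "j < m" for j
  proof -
    have "(\<lambda>k. A k $ j, if j = i then 1 else 0) \<in> V"
      unfolding V_def using j
      by (auto intro!: exI[of _ "\<lambda>k. if k = j then 1 else 0"] simp: if_distrib[of "(*) _"] cong: if_cong)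
    from \<mu>[OF this] show ?thesis unfolding \<gamma>_def by simp
  qed
  have "c $ i = of_rat (\<Sum>k<length ts. \<mu> k * \<beta> k) + (\<Sum>j<n. of_rat (\<gamma> j) * c $ j)" if c: "c \<in> C" for c
  proof -
    have "(\<Sum>j<n. of_rat (\<gamma> j) * c $ j) = (\<Sum>j<m. of_rat (\<gamma> j) * c $ j)"
      using dim \<gamma> by (intro sum.mono_neutral_left) auto
    also have "\<dots> = (\<Sum>j<m. (if j = i then c $ j else 0) - (\<Sum>k<length ts. of_rat (\<mu> k) * (of_rat (A k $ j) * c $ j)))"
      unfolding \<gamma>_def
      by (intro sum.cong) (auto simp: of_rat_diff of_rat_sum of_rat_mult sum_distrib_right left_diff_distrib mult.assoc)
    also have "\<dots> = c $ i - (\<Sum>j<m. \<Sum>k<length ts. of_rat (\<mu> k) * (of_rat (A k $ j) * c $ j))"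
      using dim by (simp add: sum_subtractf)
    also have "(\<Sum>j<m. \<Sum>k<length ts. of_rat (\<mu> k) * (of_rat (A k $ j) * c $ j)) =
        (\<Sum>k<length ts. of_rat (\<mu> k) * L (A k) c)"
      unfolding L_def by (subst sum.swap) (simp add: sum_distrib_left)
    \<comment> \<open>Each tight form is constant on \<open>C\<close>; these constants make up the
      constant term.\<close>
    also have "\<dots> = of_rat (\<Sum>k<length ts. \<mu> k * \<beta> k)"
      using A c by (simp add: of_rat_sum of_rat_mult)
    finally show ?thesis by simp
  qed
  then show ?thesis by blast
qed


subsection \<open>Definable functions\<close>

text \<open>Each new set loses the union of those already treated, and differences stay definable.
  Every block sits inside one member of \<open>Es\<close>, so it later inherits the affine formula
  of a single piece.\<close>

lemma partition_on_refinement: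
  assumes "finite Es" "\<And>E. E \<in> Es \<Longrightarrow> definable_set n E"
  shows "\<exists>Ds. finite Ds \<and> partition_on (\<Union>Es) Ds \<and> (\<forall>D\<in>Ds. definable_set n D \<and> (\<exists>E\<in>Es. D \<subseteq> E))"
  using assms
proof (induction Es rule: finite_induct)
  case empty
  show ?case by (intro exI[of _ "{}"]) (auto simp: partition_on_def)
next
  case (insert E Es)
  then obtain Ds where Ds: "finite Ds" "partition_on (\<Union>Es) Ds"
    "\<forall>D\<in>Ds. definable_set n D \<and> (\<exists>E\<in>Es. D \<subseteq> E)" by auto
  let ?D = "E - \<Union>Es"
  have "definable_set n ?D" using insert by (intro definable_set_Diff definable_set_Union) auto
  \<comment> \<open>Subtracting \<open>{{}}\<close> drops an empty remainder, as blocks must be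
    nonempty.\<close>
  moreover have "partition_on (\<Union>(insert E Es)) (Ds \<union> ({?D} - {{}}))"
  proof (cases "?D = {}")
    case True
    then have "\<Union>(insert E Es) = \<Union>Es" by blast
    then show ?thesis using Ds(2) True by simp
  next
    case False
    have U: "\<Union>Ds = \<Union>Es" using Ds(2) unfolding partition_on_def by simp
    have "disjnt ?D X" if "X \<in> Ds" for X using that U unfolding disjnt_def by blast
    then have "pairwise disjnt (insert ?D Ds)"
      using Ds(2) unfolding partition_on_def by (simp add: pairwise_insert disjnt_sym)
    then show ?thesis using False U Ds(2) unfolding partition_on_def by auto
  qed
  ultimately show ?case using Ds by (intro exI[of _ "Ds \<union> ({?D} - {{}})"]) auto
qed

definition graph_set :: "(real vec \<rightharpoonup> real vec) \<Rightarrow> real vec set" where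
  "graph_set f = {x @\<^sub>v y | x y. (x, y) \<in> Map.graph f}"

lemma graph_set_append:
  assumes "partial_fun n q f" "x \<in> carrier_vec n"
  shows "x @\<^sub>v y \<in> graph_set f \<longleftrightarrow> f x = Some y"
proof
  assume "x @\<^sub>v y \<in> graph_set f"
  then obtain x' y' where *: "x @\<^sub>v y = x' @\<^sub>v y'" "f x' = Some y'" unfolding graph_set_def Map.graph_def by auto
  have "x' \<in> carrier_vec n" using *(2) assms(1) unfolding partial_fun_def by auto
  then show "f x = Some y" using * append_vec_eq[OF assms(2), of x' y y'] by simp
next
  assume "f x = Some y"
  then show "x @\<^sub>v y \<in> graph_set f" unfolding graph_set_def Map.graph_def by auto
qed

lemma graph_setE:
  assumes "partial_fun n q f" "v \<in> graph_set f"
  obtains x y where "v = x @\<^sub>v y" "f x = Some y" "x \<in> carrier_vec n" "y \<in> carrier_vec q"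
proof -
  obtain x y where *: "v = x @\<^sub>v y" "f x = Some y" using assms(2) unfolding graph_set_def Map.graph_def by auto
  moreover have "x \<in> carrier_vec n" "y \<in> carrier_vec q"
    using *(2) assms(1) unfolding partial_fun_def by (auto simp: ran_def)
  ultimately show ?thesis using that by blast
qed

lemma graph_set_functional:
  assumes f: "partial_fun n q f" and v: "v \<in> graph_set f" and w: "w \<in> graph_set f"
    and eq: "\<forall>j<n. v $ j = w $ j"
  shows "v = w"
proof -
  obtain x y where x: "v = x @\<^sub>v y" "f x = Some y" "x \<in> carrier_vec n" "y \<in> carrier_vec q"
    by (rule graph_setE[OF f v])
  obtain x' y' where x': "w = x' @\<^sub>v y'" "f x' = Some y'" "x' \<in> carrier_vec n" "y' \<in> carrier_vec q"
    by (rule graph_setE[OF f w])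
  have "x = x'" using eq x x' by (intro eq_vecI) auto
  then show ?thesis using x x' by simp
qed

text \<open>The points of \<open>C\<close> and \<open>M\<close> vary independently, so freezing one
  of them passes functionality of the graph on to the other. \<open>D\<close> may be smaller than
  the projection because the formula restricts.\<close>

lemma simple_fun_on_polinear_projection:
  assumes f: "partial_fun n q f" and S: "polinear (n + q) S" "S \<subseteq> graph_set f"
    and D: "semi_polinear n D" "D \<subseteq> {x \<in> carrier_vec n. \<exists>y \<in> carrier_vec q. x @\<^sub>v y \<in> S}"
  shows "simple_fun n q (f |` D)"
proof -
  obtain C b M where *: "polyhedral_convex (n + q) C" "C \<noteq> {}" "C \<subseteq> unit_cube (n + q)"
    "b \<in> carrier_vec (n + q)" "fg_monoid (n + q) M"
    "S = {c + map_vec real_of_int (b + z) | c z. c \<in> C \<and> z \<in> M}"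
    using S(1) unfolding polinear_def by blast
  obtain P where P: "P \<subseteq> carrier_vec (n + q)" "finite P" "M = gen_monoid (n + q) P"
    using *(5) unfolding fg_monoid_def by blast
  have Cc: "C \<subseteq> carrier_vec (n + q)" using *(3) unfolding unit_cube_def by auto
  have Mc: "M \<subseteq> carrier_vec (n + q)" unfolding P(3) using gen_monoid_carrier P(1) by blast
  have M0: "0\<^sub>v (n + q) \<in> M" unfolding P(3) by (rule gen_monoid_zero)
  have SI: "c + map_vec real_of_int (b + z) \<in> graph_set f" if "c \<in> C" "z \<in> M" for c z
    using S(2) that unfolding *(6) by blast
  obtain c0 where c0: "c0 \<in> C" using *(2) by auto
  have "D \<subseteq> dom f"
  proof
    fix x assume "x \<in> D"
    then obtain y where "x \<in> carrier_vec n" "x @\<^sub>v y \<in> graph_set f" using D(2) S(2) by blast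
    then show "x \<in> dom f" using graph_set_append[OF f] by blast
  qed
  then have dom: "dom (f |` D) = D" by auto
  have "simple_scalar n (\<lambda>x. map_option (\<lambda>y. y $ i) ((f |` D) x))" if i: "i < q" for i
  proof -
    have "\<exists>(\<alpha> :: rat) (a :: nat \<Rightarrow> rat). \<forall>c\<in>C. c $ (n + i) = of_rat \<alpha> + (\<Sum>j<n. of_rat (a j) * c $ j)"
    proof (rule polyhedral_functional_affine[OF *(1,2)])
      fix c c' assume c: "c \<in> C" "c' \<in> C" "\<forall>j<n. c $ j = c' $ j"
      \<comment> \<open>The monoid part is frozen at 0.\<close>
      let ?v = "\<lambda>c. c + map_vec real_of_int (b + 0\<^sub>v (n + q))"
      have "?v c = ?v c'"
        by (rule graph_set_functional[OF f SI SI]) (use c * M0 Cc in auto)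
      then have "?v c $ (n + i) = ?v c' $ (n + i)" by simp
      then show "c $ (n + i) = c' $ (n + i)" using c Cc *(4) i by auto
    qed (use i in auto)
    then obtain \<alpha> a where a: "\<And>c. c \<in> C \<Longrightarrow> c $ (n + i) = of_rat \<alpha> + (\<Sum>j<n. of_rat (a j) * c $ j)" by blast
    have "\<exists>b' :: nat \<Rightarrow> rat. \<forall>z\<in>M. of_int (z $ (n + i)) = (\<Sum>j<n. b' j * of_int (z $ j))"
    proof (rule monoid_functional_linear[OF Mc])
      show "x + y \<in> M" if "x \<in> M" "y \<in> M" for x y
        using gen_monoid_plus[OF _ _ P(1)] that unfolding P(3) by blast
    next
      fix z z' assume z: "z \<in> M" "z' \<in> M" "\<forall>j<n. z $ j = z' $ j"
      have dims: "z \<in> carrier_vec (n + q)" "z' \<in> carrier_vec (n + q)" using z Mc by auto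
      \<comment> \<open>The cube part is frozen at \<open>c0\<close>.\<close>
      let ?v = "\<lambda>z. c0 + map_vec real_of_int (b + z)"
      have "?v z = ?v z'"
        by (rule graph_set_functional[OF f SI SI]) (use z * c0 dims Cc in auto)
      then have "?v z $ (n + i) = ?v z' $ (n + i)" by simp
      then show "z $ (n + i) = z' $ (n + i)" using dims *(4) i by auto
    qed (use i M0 in auto)
    then obtain b' where b': "\<And>z. z \<in> M \<Longrightarrow> rat_of_int (z $ (n + i)) = (\<Sum>j<n. b' j * of_int (z $ j))" by blast
    have b'': "real_of_int (z $ (n + i)) = (\<Sum>j<n. of_rat (b' j) * of_int (z $ j))" if "z \<in> M" for z
      using arg_cong[OF b'[OF that], of "of_rat :: rat \<Rightarrow> real"] by (simp add: of_rat_sum of_rat_mult)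
    \<comment> \<open>The integer part of a point is \<open>b + z'\<close> with \<open>z'\<close> in
      \<open>M\<close>, so the linear form applies to \<open>z - b\<close>; its value at
      \<open>b\<close> moves into the constant, together with the offset of the output
      coordinate.\<close>
    define \<gamma> where "\<gamma> = \<alpha> + of_int (b $ (n + i)) - (\<Sum>j<n. b' j * of_int (b $ j))"
    have "map_option (\<lambda>y. y $ i) ((f |` D) (c + map_vec real_of_int z)) = Some (of_rat \<gamma> +
        (\<Sum>j<n. of_rat (vec n a $ j) * c $ j + of_rat (vec n b' $ j) * real_of_int (z $ j)))"
      if c: "c \<in> unit_cube n" and z: "z \<in> carrier_vec n" and D': "c + map_vec real_of_int z \<in> D" for c z
    proof -
      let ?x = "c + map_vec real_of_int z"
      obtain y where y: "y \<in> carrier_vec q" "?x @\<^sub>v y \<in> S" and xn: "?x \<in> carrier_vec n"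
        using D' D(2) by blast
      have fx: "f ?x = Some y" using y(2) S(2) graph_set_append[OF f xn] by blast
      obtain c' z' where cz: "?x @\<^sub>v y = c' + map_vec real_of_int (b + z')" "c' \<in> C" "z' \<in> M"
        using y(2) *(6) by blast
      have dims: "c' \<in> unit_cube (n + q)" "c' \<in> carrier_vec (n + q)" "z' \<in> carrier_vec (n + q)"
        "b + z' \<in> carrier_vec (n + q)" "c \<in> carrier_vec n"
        using cz(2,3) *(3,4) Cc Mc c unfolding unit_cube_def by auto
      \<comment> \<open>Uniqueness of floor and fractional part identifies the two decompositions on
        the first \<open>n\<close> coordinates.\<close>
      have j: "c' $ j = c $ j \<and> z' $ j = z $ j - b $ j" if "j < n" for j
      proof -
        have "(?x @\<^sub>v y) $ j = ?x $ j" using that dims z by (subst index_append_vec) auto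
        then have "(c' + map_vec real_of_int (b + z')) $ j = ?x $ j" unfolding cz(1) .
        then show ?thesis
          using unit_cube_add_int[OF dims(1,4), of j] unit_cube_add_int[OF c z that] that *(4) dims by auto
      qed
      have "y $ i = (?x @\<^sub>v y) $ (n + i)" using i dims z y(1) by (subst index_append_vec) auto
      also have "\<dots> = c' $ (n + i) + (of_int (b $ (n + i)) + of_int (z' $ (n + i)))"
        unfolding cz(1) using i dims *(4) by auto
      also have "\<dots> = of_rat \<alpha> + (\<Sum>j<n. of_rat (a j) * c $ j) +
          (of_int (b $ (n + i)) + (\<Sum>j<n. of_rat (b' j) * (of_int (z $ j) - of_int (b $ j))))"
        unfolding a[OF cz(2)] b''[OF cz(3)] using j by simp
      also have "\<dots> = of_rat \<gamma> + (\<Sum>j<n. of_rat (vec n a $ j) * c $ j + of_rat (vec n b' $ j) * real_of_int (z $ j))"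
        unfolding \<gamma>_def
        by (simp add: of_rat_add of_rat_diff of_rat_sum of_rat_mult right_diff_distrib sum_subtractf sum.distrib)
      finally show ?thesis using fx D' by simp
    qed
    moreover have "dom (\<lambda>x. map_option (\<lambda>y. y $ i) ((f |` D) x)) = D" using dom by (auto simp: dom_def)
    ultimately show ?thesis unfolding simple_scalar_def using D(1)
      by (intro conjI exI[of _ \<gamma>] exI[of _ "vec n a"] exI[of _ "vec n b'"]) auto
  qed
  then show ?thesis unfolding simple_fun_def using D(1) dom by simp
qed

lemma definable_imp_piecewise_simple:
  assumes f: "partial_fun n q f" and "definable_fun n q f"
  shows "piecewise_simple n q f"
proof -
  have "semi_polinear (n + q) (graph_set f)"
    using assms(2) definable_set_semi_polinear unfolding definable_fun_def graph_set_def by blast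
  then obtain F where F: "finite F" "\<And>S. S \<in> F \<Longrightarrow> polinear (n + q) S" "graph_set f = \<Union>F"
    unfolding semi_polinear_def by blast
  define pr where "pr S = {x \<in> carrier_vec n. \<exists>y \<in> carrier_vec q. x @\<^sub>v y \<in> S}" for S :: "real vec set"
  have "definable_set n (pr S)" if "S \<in> F" for S
    unfolding pr_def by (rule definable_set_projection[OF polinear_definable[OF F(2)[OF that]]])
  then obtain Ds where Ds: "finite Ds" "partition_on (\<Union>(pr ` F)) Ds"
    "\<forall>D\<in>Ds. definable_set n D \<and> (\<exists>E\<in>pr ` F. D \<subseteq> E)"
    using partition_on_refinement[of "pr ` F" n] F(1) by auto
  have "\<Union>(pr ` F) = dom f"
  proof (intro equalityI subsetI)
    fix x assume "x \<in> \<Union>(pr ` F)"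
    then obtain y where "x \<in> carrier_vec n" "x @\<^sub>v y \<in> graph_set f" unfolding pr_def F(3) by blast
    then show "x \<in> dom f" using graph_set_append[OF f] by blast
  next
    fix x assume "x \<in> dom f"
    then obtain y where y: "f x = Some y" by blast
    then have "x \<in> carrier_vec n" "y \<in> carrier_vec q" using f unfolding partial_fun_def by (auto simp: ran_def)
    moreover have "x @\<^sub>v y \<in> \<Union>F" using y graph_set_append[OF f calculation(1)] F(3) by blast
    ultimately show "x \<in> \<Union>(pr ` F)" unfolding pr_def by blast
  qed
  moreover have "semi_polinear n D \<and> simple_fun n q (f |` D)" if D: "D \<in> Ds" for D
  proof -
    obtain S where S: "S \<in> F" "D \<subseteq> pr S" using Ds(3)[rule_format, OF D] by auto
    have "semi_polinear n D" using Ds(3) D definable_set_semi_polinear by blast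
    then show ?thesis
      using simple_fun_on_polinear_projection[OF f F(2)[OF S(1)], of D] S F(3) unfolding pr_def by blast
  qed
  ultimately show ?thesis unfolding piecewise_simple_def using Ds by auto
qed

text \<open>Reading c as fractional parts and z as floors of the variables turns the simple formula
  into a definable value.\<close>

lemma simple_fun_definable_coordinate:
  assumes D: "D \<subseteq> dom f" "D \<subseteq> carrier_vec n" and simple: "simple_fun n q (f |` D)" and i: "i < q"
  shows "\<exists>g. definable_val g \<and> (\<forall>e. vec n e \<in> D \<longrightarrow> (\<exists>y. f (vec n e) = Some y \<and> y $ i = g e))"
proof -
  have "simple_scalar n (\<lambda>x. map_option (\<lambda>y. y $ i) ((f |` D) x))" (is "simple_scalar n ?f")
    using simple i unfolding simple_fun_def by blast
  then obtain \<alpha> :: rat and a b :: "rat vec" where ab: "\<And>c z. c \<in> unit_cube n \<Longrightarrow> z \<in> carrier_vec n \<Longrightarrow>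
      c + map_vec real_of_int z \<in> dom ?f \<Longrightarrow> ?f (c + map_vec real_of_int z) =
        Some (of_rat \<alpha> + (\<Sum>i<n. of_rat (a $ i) * c $ i + of_rat (b $ i) * real_of_int (z $ i)))"
    unfolding simple_scalar_def by blast
  let ?g = "\<lambda>e. of_rat \<alpha> + (\<Sum>j<n. of_rat (a $ j) * frac (e j) + of_rat (b $ j) * of_int \<lfloor>e j\<rfloor>) :: real"
  have "definable_val ?g"
    by (intro definable_val_add definable_val_sum definable_val_of_rat definable_val_of_rat_mult
      definable_val_frac definable_val_floor definable_val_var finite_lessThan)
  moreover have "\<exists>y. f (vec n e) = Some y \<and> y $ i = ?g e" if e: "vec n e \<in> D" for e
  proof -
    let ?c = "vec n (\<lambda>j. frac (e j))" and ?z = "vec n (\<lambda>j. \<lfloor>e j\<rfloor>)"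
    have x: "vec n e = ?c + map_vec real_of_int ?z" by (intro eq_vecI) (auto simp: frac_def)
    have "?c \<in> unit_cube n" unfolding unit_cube_def by (auto simp: frac_lt_1)
    moreover obtain y where y: "f (vec n e) = Some y" using e D(1) by blast
    have fe: "?f (vec n e) = Some (y $ i)" using e y by simp
    moreover have "?c + map_vec real_of_int ?z \<in> dom ?f" using fe unfolding x[symmetric] by (rule domI)
    ultimately have "?f (vec n e) = Some (of_rat \<alpha> + (\<Sum>i<n. of_rat (a $ i) * ?c $ i + of_rat (b $ i) * real_of_int (?z $ i)))"
      using ab[of ?c ?z] unfolding x[symmetric] by simp
    then show ?thesis using y fe by simp
  qed
  ultimately show ?thesis by blast
qed

lemma piecewise_simple_imp_definable:
  assumes f: "partial_fun n q f" and "piecewise_simple n q f"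
  shows "definable_fun n q f"
proof -
  obtain Ds where Ds: "finite Ds" "partition_on (dom f) Ds"
    "\<And>D. D \<in> Ds \<Longrightarrow> semi_polinear n D \<and> simple_fun n q (f |` D)"
    using assms(2) unfolding piecewise_simple_def by blast
  have U: "\<Union>Ds = dom f" using Ds(2) unfolding partition_on_def by simp
  have domn: "dom f \<subseteq> carrier_vec n" using f unfolding partial_fun_def by simp
  have "\<exists>g. definable_val g \<and> (\<forall>e. vec n e \<in> D \<longrightarrow> (\<exists>y. f (vec n e) = Some y \<and> y $ i = g e))"
    if "D \<in> Ds" "i < q" for D i
    by (rule simple_fun_definable_coordinate) (use that U domn Ds(3) in auto)
  then obtain g where g: "\<And>D i. D \<in> Ds \<Longrightarrow> i < q \<Longrightarrow> definable_val (g D i)"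
    "\<And>D i e. D \<in> Ds \<Longrightarrow> i < q \<Longrightarrow> vec n e \<in> D \<Longrightarrow> \<exists>y. f (vec n e) = Some y \<and> y $ i = g D i e"
    by metis
  \<comment> \<open>The first \<open>n\<close> variables hold the argument, the next
    \<open>q\<close> the value, with one disjunct per block.\<close>
  have "definable_pred (\<lambda>e. \<exists>D\<in>Ds. vec n e \<in> D \<and> (\<forall>i<q. e (n + i) = g D i e))"
    using Ds(1,3) g(1) semi_polinear_definable
    by (intro definable_pred_bex definable_pred_conj definable_pred_all_less definable_pred_eq definable_val_var)
      (auto simp: definable_set_iff)
  moreover have "vec (n + q) e \<in> graph_set f \<longleftrightarrow> (\<exists>D\<in>Ds. vec n e \<in> D \<and> (\<forall>i<q. e (n + i) = g D i e))" for e
  proof -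
    have split: "vec (n + q) e = vec n e @\<^sub>v vec q (\<lambda>i. e (n + i))" by (intro eq_vecI) auto
    have "vec (n + q) e \<in> graph_set f \<longleftrightarrow> f (vec n e) = Some (vec q (\<lambda>i. e (n + i)))"
      unfolding split by (rule graph_set_append[OF f]) simp
    also have "\<dots> \<longleftrightarrow> (\<exists>D\<in>Ds. vec n e \<in> D \<and> (\<forall>i<q. e (n + i) = g D i e))"
    proof
      assume fe: "f (vec n e) = Some (vec q (\<lambda>i. e (n + i)))"
      then obtain D where D: "D \<in> Ds" "vec n e \<in> D" using U by blast
      then show "\<exists>D\<in>Ds. vec n e \<in> D \<and> (\<forall>i<q. e (n + i) = g D i e)"
        using g(2)[OF D(1) _ D(2)] fe by (intro bexI[of _ D]) auto
    next
      assume "\<exists>D\<in>Ds. vec n e \<in> D \<and> (\<forall>i<q. e (n + i) = g D i e)"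
      then obtain D where D: "D \<in> Ds" "vec n e \<in> D" "\<forall>i<q. e (n + i) = g D i e" by blast
      obtain y where y: "f (vec n e) = Some y" using D U by blast
      have "y \<in> carrier_vec q" using y f unfolding partial_fun_def by (auto simp: ran_def)
      moreover have "y $ i = e (n + i)" if "i < q" for i using g(2)[OF D(1) that D(2)] D(3) y that by auto
      ultimately have "y = vec q (\<lambda>i. e (n + i))" by (intro eq_vecI) auto
      then show "f (vec n e) = Some (vec q (\<lambda>i. e (n + i)))" using y by simp
    qed
    finally show ?thesis .
  qed
  moreover have "graph_set f \<subseteq> carrier_vec (n + q)" by (auto elim!: graph_setE[OF f])
  ultimately have "definable_set (n + q) (graph_set f)" unfolding definable_set_iff by simp
  then show ?thesis unfolding definable_fun_def graph_set_def .
qed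

theorem theorem5p9:
  fixes n q :: nat and f :: "real vec \<rightharpoonup> real vec"
  assumes "n \<ge> 1" and "q \<ge> 1"
    and "partial_fun n q f"
  shows "definable_fun n q f \<longleftrightarrow> piecewise_simple n q f"
  using definable_imp_piecewise_simple piecewise_simple_imp_definable assms(3) by blast

end
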